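(* Let $n\in\mathbb{N}$ and let $i\in\mathbb{N}$ with $2\le i\le 2^n$. Let $f\in\mathbb{Q}^n\setminus\mathbb{Z}^n$, and let $s$ be the denominator of $f$. If $i\le n$, then $\rho_f(\mathcal{L}_i^n,\mathcal{L}_{i+1}^n)=\infty$. If $i>n$, then $\rho_f(\mathcal{L}_i^n,\mathcal{L}_*^n)\le\operatorname{Flt}(n)4^{n-1}s$.
   Context: The denominator of $u\in\mathbb{Q}^n\setminus\{0\}$ is the minimal $s\in\mathbb{N}$ with $su\in\mathbb{Z}^n$. $\mathcal{C}^n$ is the family of all $n$-dimensional closed convex subsets of $\mathbb{R}^n$. A set $B\subseteq\mathbb{R}^n$ is lattice-free if $B\in\mathcal{C}^n$ and $\operatorname{int}(B)\cap\mathbb{Z}^n=\emptyset$. For $i\in\mathbb{N}$, $\mathcal{L}_i^n$ is the family of all lattice-free polyhedra in $\mathbb{R}^n$ with at most $i$ facets, and $\mathcal{L}_*^n$ is the family of all lattice-free polyhedra in $\mathbb{R}^n$. For $B\in\mathcal{C}^n$ with $0\in\operatorname{int}(B)$, $\psi_B(r)=\inf\{\lambda>0:r\in\lambda B\}$. For $k\in\mathbb{N}$, $R=(r_1,\dots,r_k)\in\mathbb{R}^{n\times k}$, $f\in\mathbb{R}^n\setminus\mathbb{Z}^n$, $B\in\mathcal{C}^n$: if $f\in\operatorname{int}(B)$, $C_B(R,f)=\{s\in\mathbb{R}^k_{\ge0}:\sum_j s_j\psi_{B-f}(r_j)\ge1\}$, otherwise $C_B(R,f)=\mathbb{R}^k_{\ge0}$;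 for $\mathcal{B}\subseteq\mathcal{C}^n$, $C_{\mathcal{B}}(R,f)=\bigcap_{B\in\mathcal{B}}C_B(R,f)$ ($=\mathbb{R}^k_{\ge0}$ if $\mathcal{B}=\emptyset$). For $\mathcal{B},\mathcal{L}\subseteq\mathcal{C}^n$, $\rho_f(\mathcal{B},\mathcal{L})=\inf\{\alpha>0: C_{\mathcal{B}}(R,f)\subseteq\frac1\alpha C_{\mathcal{L}}(R,f)$ for all $k$ and all $R\in\mathbb{R}^{n\times k}\}$. The lattice width of nonempty $X$ is $w(X)=\inf_{u\in\mathbb{Z}^n\setminus\{0\}}(\sup_{x\in X}u\cdot x-\inf_{x\in X}u\cdot x)$, and $\operatorname{Flt}(n)=\sup\{w(B):B$ lattice-free in $\mathbb{R}^n\}$ (finite). *)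

theory Defs
  imports "HOL-Analysis.Analysis" "HOL-Library.Extended_Real"
begin

definition int_vec :: "real^'n \<Rightarrow> bool" where
  "int_vec x \<longleftrightarrow> (\<forall>j. x $ j \<in> \<int>)"

definition rat_vec :: "real^'n \<Rightarrow> bool" where
  "rat_vec x \<longleftrightarrow> (\<forall>j. x $ j \<in> \<rat>)"

definition denom_vec :: "real^'n \<Rightarrow> nat" where
  "denom_vec u = (LEAST s::nat. s > 0 \<and> int_vec (real s *\<^sub>R u))"

definition full_closed_convex :: "(real^'n) set \<Rightarrow> bool" where
  "full_closed_convex B \<longleftrightarrow> closed B \<and> convex B \<and> aff_dim B = int CARD('n)"

definition lattice_free :: "(real^'n) set \<Rightarrow> bool" where
  "lattice_free B \<longleftrightarrow> full_closed_convex B \<and> (\<forall>z \<in> interior B. \<not> int_vec z)"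

definition Lfam :: "nat \<Rightarrow> (real^'n) set set" where
  "Lfam i = {B. lattice_free B \<and> polyhedron B \<and> card {F. F facet_of B} \<le> i}"

definition Lstar :: "(real^'n) set set" where
  "Lstar = {B. lattice_free B \<and> polyhedron B}"

definition gauge :: "(real^'n) set \<Rightarrow> real^'n \<Rightarrow> real" where
  "gauge B r = Inf {t. t > 0 \<and> r \<in> (\<lambda>x. t *\<^sub>R x) ` B}"

(* R^k_{\<ge>0}, with vectors in R^k represented as functions nat \<Rightarrow> real vanishing from k on *)
definition orthant :: "nat \<Rightarrow> (nat \<Rightarrow> real) set" where
  "orthant k = {s. (\<forall>j<k. 0 \<le> s j) \<and> (\<forall>j\<ge>k. s j = 0)}"

definition cut_set :: "(real^'n) set \<Rightarrow> nat \<Rightarrow> (nat \<Rightarrow> real^'n) \<Rightarrow> real^'n \<Rightarrow> (nat \<Rightarrow> real) set" where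
  "cut_set B k R f =
     (if f \<in> interior B
      then {s \<in> orthant k. (\<Sum>j<k. s j * gauge ((\<lambda>x. x - f) ` B) (R j)) \<ge> 1}
      else orthant k)"

definition cut_fam :: "(real^'n) set set \<Rightarrow> nat \<Rightarrow> (nat \<Rightarrow> real^'n) \<Rightarrow> real^'n \<Rightarrow> (nat \<Rightarrow> real) set" where
  "cut_fam \<B> k R f = {s \<in> orthant k. \<forall>B\<in>\<B>. s \<in> cut_set B k R f}"

(* rho_f(B, L) as an extended real; Inf {} = \<infinity> *)
definition rho :: "real^'n \<Rightarrow> (real^'n) set set \<Rightarrow> (real^'n) set set \<Rightarrow> ereal" where
  "rho f \<B> \<L> = Inf {ereal \<alpha> | \<alpha>. \<alpha> > 0 \<and>
      (\<forall>k R. cut_fam \<B> k R f \<subseteq> (\<lambda>s j. s j / \<alpha>) ` cut_fam \<L> k R f)}"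

definition lattice_width :: "(real^'n) set \<Rightarrow> ereal" where
  "lattice_width X = (INF u \<in> {u. int_vec u \<and> u \<noteq> 0}.
      (SUP x\<in>X. ereal (u \<bullet> x)) - (INF x\<in>X. ereal (u \<bullet> x)))"

definition Flt :: "'n::finite itself \<Rightarrow> ereal" where
  "Flt _ = (SUP B \<in> {B :: (real^'n) set. lattice_free B}. lattice_width B)"

end

theory Submission
  imports Defs
begin

text \<open>For \<open>i > n\<close>, put \<open>K = B - f\<close> and induct on the dimension of an integral subspace \<open>V\<close>, producing
  \<open>dim V + 1\<close> linear constraints that are bounded on \<open>K \<inter> V\<close> and exclude all integer points of \<open>f + V\<close>.
  By flatness \<open>K \<inter> V\<close> is thin in a primitive integral direction \<open>u\<close>. If \<open>u \<bullet> f\<close> is not an integer, it has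
  distance at least \<open>1/s\<close> from the integers and a split does the job. Otherwise take the constraints for the
  slice \<open>u = 0\<close> of \<open>K \<inter> V\<close>, extend them to \<open>K \<inter> V\<close> by a Hahn-Banach argument, tilt them by \<open>\<plusminus>u\<close>, and add one
  constraint on \<open>u\<close> itself. Since the weighted sum of the old constraints vanishes on the slice, that of the
  tilted ones is a multiple of \<open>u\<close>, so together they leave no integer point off the slice. Each step adds
  at most the width to the bound, so the resulting factor \<open>n\<close> is below \<open>4\<^bsup>n-1\<^esup>\<close>.

  For \<open>i \<le> n\<close>, choose an integral basis in which \<open>f\<close> is a multiple of the basis vector \<open>b\<^sub>m\<close>,
  \<open>m = i - 1\<close>, and build an iterated pyramid over a segment around \<open>f\<close> on the line \<open>\<real> b\<^sub>m\<close>, so steep that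
  it stays wide after shrinking towards \<open>f\<close>. A lattice-free body with at most \<open>i\<close> facets has
  linearly dependent normals (otherwise it contains a full-dimensional cone), hence contains a line
  inside the \<open>i\<close>-dimensional span of the first basis vectors; translating the shrunken pyramid along
  that line sweeps over an integer point.\<close>

section \<open>Integral vectors\<close>

lemma int_vec_0 [simp]: "int_vec 0"
  by (simp add: int_vec_def)

lemma int_vec_add: "int_vec x \<Longrightarrow> int_vec y \<Longrightarrow> int_vec (x + y)"
  by (simp add: int_vec_def)

lemma int_vec_diff: "int_vec x \<Longrightarrow> int_vec y \<Longrightarrow> int_vec (x - y)"
  by (simp add: int_vec_def)

lemma int_vec_scaleR: "c \<in> \<int> \<Longrightarrow> int_vec x \<Longrightarrow> int_vec (c *\<^sub>R x)"
  by (simp add: int_vec_def)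

lemma int_vec_sum: "(\<And>j. j \<in> J \<Longrightarrow> int_vec (h j)) \<Longrightarrow> int_vec (sum h J)"
  by (auto simp: int_vec_def intro!: Ints_sum)

lemma int_vec_axis [simp]: "int_vec (axis j 1)"
  by (simp add: int_vec_def axis_def)

lemma int_vec_inner: "int_vec x \<Longrightarrow> int_vec y \<Longrightarrow> x \<bullet> y \<in> \<int>"
  by (auto simp: int_vec_def inner_vec_def intro!: Ints_sum)

lemma Ints_cases_nat:
  fixes x :: real
  assumes "x \<in> \<int>" "x > 0"
  obtains n :: nat where "n > 0" "x = real n"
proof -
  obtain k where k: "x = of_int k" using assms(1) Ints_cases by blast
  show thesis using that[of "nat k"] k assms(2) by simp
qed

text \<open>Division with remainder: the least positive value \<open>g\<close> of \<open>u\<close>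
  on integral vectors divides every other value, so \<open>u / g\<close> is integral and the vector
  attaining \<open>g\<close> is a Bezout witness.\<close>

lemma int_vec_primitive:
  fixes u :: "real^'n"
  assumes u: "int_vec u" "u \<noteq> 0"
  obtains g u' y where "g \<ge> (1::real)" "int_vec u'" "int_vec y" "u = g *\<^sub>R u'" "u' \<bullet> y = 1"
proof -
  define S where "S = {n::nat. n > 0 \<and> (\<exists>y. int_vec y \<and> u \<bullet> y = real n)}"
  obtain n where "n > 0" "u \<bullet> u = real n"
    using Ints_cases_nat[OF int_vec_inner[OF u(1) u(1)]] u(2) by auto
  then have "n \<in> S" using u by (auto simp: S_def)
  define g where "g = (LEAST n. n \<in> S)"
  have gS: "g \<in> S" unfolding g_def using \<open>n \<in> S\<close> by (rule LeastI)
  then obtain y where y: "g > 0" "int_vec y" "u \<bullet> y = real g" by (auto simp: S_def)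
  have div: "u \<bullet> x / g \<in> \<int>" if "int_vec x" for x
  proof -
    define q where "q = \<lfloor>u \<bullet> x / g\<rfloor>"
    define r where "r = u \<bullet> x - q * real g"
    have r: "r = u \<bullet> (x - of_int q *\<^sub>R y)" by (simp add: r_def inner_diff_right y)
    have iv: "int_vec (x - of_int q *\<^sub>R y)"
      by (intro int_vec_diff int_vec_scaleR that y) auto
    have "q \<le> u \<bullet> x / g" "u \<bullet> x / g < q + 1" unfolding q_def by linarith+
    then have r0: "0 \<le> r" "r < g" using y(1) by (auto simp: r_def field_simps)
    have "r = 0"
    proof (rule ccontr)
      assume "r \<noteq> 0"
      then obtain m where m: "m > 0" "r = real m"
        using Ints_cases_nat[of r] int_vec_inner[OF u(1) iv] r r0 by force
      then have "m \<in> S" using r iv by (auto simp: S_def)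
      then have "g \<le> m" unfolding g_def by (rule Least_le)
      then show False using r0 m by simp
    qed
    then show ?thesis using y(1) by (simp add: r_def)
  qed
  have "u $ j / g \<in> \<int>" for j using div[of "axis j 1"] by (simp add: inner_axis)
  then have "int_vec ((1 / real g) *\<^sub>R u)" by (simp add: int_vec_def)
  then show thesis using that[of "real g" "(1 / real g) *\<^sub>R u" y] y by auto
qed

lemma int_vec_round:
  fixes x :: "real^'n"
  obtains z where "int_vec z" "norm (z - x) \<le> CARD('n)"
proof
  define z :: "real^'n" where "z = (\<chi> j. of_int (round (x $ j)))"
  show "int_vec z" by (simp add: z_def int_vec_def)
  have "norm (z - x) \<le> (\<Sum>j\<in>UNIV. \<bar>(z - x) $ j\<bar>)" by (rule norm_le_l1_cart)
  also have "\<dots> \<le> (\<Sum>j\<in>(UNIV::'n set). 1)"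
  proof (rule sum_mono)
    fix j
    show "\<bar>(z - x) $ j\<bar> \<le> 1" using of_int_round_abs_le[of "x $ j"] by (simp add: z_def)
  qed
  finally show "norm (z - x) \<le> CARD('n)" by simp
qed

text \<open>\<open>LEAST\<close> is informative only once some positive multiple of \<open>f\<close>
  is known to be integral; the product of the coordinate denominators gives one.\<close>

lemma
  fixes f :: "real^'n"
  assumes "rat_vec f"
  shows denom_vec_pos: "denom_vec f > 0"
    and int_vec_denom_vec: "int_vec (real (denom_vec f) *\<^sub>R f)"
proof -
  have "\<exists>d::nat. d > 0 \<and> real d * f $ j \<in> \<int>" for j
  proof -
    have "f $ j \<in> \<rat>" using assms by (simp add: rat_vec_def)
    then obtain a b where ab: "b > 0" "f $ j = of_int a / of_int b"
      by (rule Rats_cases')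
    then show ?thesis by (intro exI[of _ "nat b"]) (simp add: field_simps)
  qed
  then obtain d where d: "\<And>j. d j > (0::nat)" "\<And>j. real (d j) * f $ j \<in> \<int>" by metis
  define D where "D = (\<Prod>j\<in>UNIV. d j)"
  have "D > 0" using d by (simp add: D_def prod_pos)
  moreover have "real D * f $ j \<in> \<int>" for j
  proof -
    have "D = (\<Prod>l\<in>UNIV - {j}. d l) * d j"
      unfolding D_def by (subst prod.remove[of UNIV j]) auto
    then have "real D * f $ j = real (\<Prod>l\<in>UNIV - {j}. d l) * (real (d j) * f $ j)" by simp
    then show ?thesis using d(2) by (metis Ints_mult Ints_of_nat)
  qed
  ultimately have "D > 0 \<and> int_vec (real D *\<^sub>R f)" by (simp add: int_vec_def)
  from LeastI[of "\<lambda>s. s > 0 \<and> int_vec (real s *\<^sub>R f)", OF this]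
  show "denom_vec f > 0" "int_vec (real (denom_vec f) *\<^sub>R f)" by (auto simp: denom_vec_def)
qed

section \<open>Polyhedra around an interior point\<close>

text \<open>The polar of \<open>G\<close> translated by \<open>f\<close>. With slack normalised to 1
  at \<open>f\<close>, dilation about \<open>f\<close> only rescales the right-hand side, and
  \<open>g = 0\<close> is a harmless member.\<close>

definition polyh :: "(real^'n) set \<Rightarrow> real^'n \<Rightarrow> (real^'n) set" where
  "polyh G f = {x. \<forall>g\<in>G. g \<bullet> (x - f) \<le> 1}"

lemma polyhedron_polyh:
  assumes "finite G"
  shows "polyhedron (polyh G f)"
proof -
  have "polyh G f = \<Inter> ((\<lambda>g. {x. g \<bullet> x \<le> 1 + g \<bullet> f}) ` G)"
    by (auto simp: polyh_def inner_diff_right algebra_simps)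
  then show ?thesis using assms by (auto intro: polyhedron_Inter polyhedron_halfspace_le)
qed

lemma interior_polyh:
  assumes "finite G"
  shows "interior (polyh G f) = {x. \<forall>g\<in>G. g \<bullet> (x - f) < 1}"
proof
  have "{x. \<forall>g\<in>G. g \<bullet> (x - f) < 1} = \<Inter> ((\<lambda>g. {x. g \<bullet> x < 1 + g \<bullet> f}) ` G)"
    by (auto simp: inner_diff_right algebra_simps)
  then have "open {x. \<forall>g\<in>G. g \<bullet> (x - f) < 1}"
    using assms by (auto intro: open_halfspace_lt)
  then show "{x. \<forall>g\<in>G. g \<bullet> (x - f) < 1} \<subseteq> interior (polyh G f)"
    by (intro interior_maximal) (auto simp: polyh_def less_imp_le)
  show "interior (polyh G f) \<subseteq> {x. \<forall>g\<in>G. g \<bullet> (x - f) < 1}"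
  proof safe
    fix x g assume x: "x \<in> interior (polyh G f)" and g: "g \<in> G"
    show "g \<bullet> (x - f) < 1"
    proof (cases "g = 0")
      case False
      have "x \<in> interior {x. g \<bullet> x \<le> 1 + g \<bullet> f}"
        using x by (rule set_mp[OF interior_mono, rotated])
          (use g in \<open>auto simp: polyh_def inner_diff_right algebra_simps\<close>)
      then show ?thesis using False by (simp add: inner_diff_right algebra_simps)
    qed simp
  qed
qed

text \<open>Every facet equals the face cut out by a constraint active at one of its relative
  interior points: that face contains the facet and is proper, so the dimensions force
  equality.\<close>

lemma card_facets_polyh:
  assumes "finite G"
  shows "card {c. c facet_of polyh G f} \<le> card G"
proof -
  let ?S = "polyh G f"
  have cS: "convex ?S" using polyhedron_polyh[OF assms] polyhedron_imp_convex by blast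
  have fS: "f \<in> interior ?S" by (simp add: interior_polyh assms)
  have "{c. c facet_of ?S} \<subseteq> (\<lambda>g. ?S \<inter> {x. g \<bullet> x = 1 + g \<bullet> f}) ` G"
  proof safe
    fix c assume c: "c facet_of ?S"
    then have cf: "c face_of ?S" "c \<noteq> {}" "aff_dim c = aff_dim ?S - 1" by (auto simp: facet_of_def)
    have cc: "convex c" using cf(1) face_of_imp_convex by blast
    obtain x where x: "x \<in> rel_interior c" using cf(2) cc rel_interior_eq_empty by blast
    have "x \<in> c" using x rel_interior_subset by blast
    have "c \<noteq> ?S" using cf(3) by auto
    then have "x \<notin> interior ?S" using face_of_disjoint_interior[OF cf(1)] \<open>x \<in> c\<close> by auto
    then obtain g where g: "g \<in> G" "g \<bullet> (x - f) \<ge> 1" by (auto simp: interior_polyh assms not_less)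
    have "x \<in> ?S" using \<open>x \<in> c\<close> cf(1) face_of_imp_subset by blast
    then have gx: "g \<bullet> x = 1 + g \<bullet> f" using g by (force simp: polyh_def inner_diff_right)
    define F where "F = ?S \<inter> {x. g \<bullet> x = 1 + g \<bullet> f}"
    have F: "F face_of ?S" unfolding F_def
      by (rule face_of_Int_supporting_hyperplane_le[OF cS])
        (use g in \<open>auto simp: polyh_def inner_diff_right algebra_simps\<close>)
    have "c \<subseteq> F"
      by (rule subset_of_face_of[OF F face_of_imp_subset[OF cf(1)]])
        (use x gx \<open>x \<in> ?S\<close> in \<open>auto simp: F_def disjoint_iff\<close>)
    then have cF: "c face_of F" using cf(1) F face_of_subset face_of_imp_subset by blast
    have "f \<notin> F" by (simp add: F_def)
    then have "F \<noteq> ?S" using fS interior_subset by blast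
    then have "aff_dim F < aff_dim ?S" using face_of_aff_dim_lt[OF cS F] by simp
    then have "c = F" using face_of_aff_dim_lt[OF face_of_imp_convex[OF F] cF] cf(3) by fastforce
    then show "c \<in> (\<lambda>g. ?S \<inter> {x. g \<bullet> x = 1 + g \<bullet> f}) ` G" using g(1) by (auto simp: F_def)
  qed
  then show ?thesis using assms by (meson card_image_le card_mono finite_imageI le_trans)
qed

lemma polyh_in_Lfam:
  fixes G :: "(real^'n) set"
  assumes "finite G" "card G \<le> m"
    and free: "\<And>z. int_vec z \<Longrightarrow> \<exists>g\<in>G. g \<bullet> (z - f) \<ge> 1"
  shows "polyh G f \<in> Lfam m"
proof -
  have "interior (polyh G f) \<noteq> {}" using interior_polyh[OF assms(1), of f] by (auto intro!: exI[of _ f])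
  then have "aff_dim (polyh G f) = int CARD('n)"
    using aff_dim_nonempty_interior[of "polyh G f"] by simp
  then have "full_closed_convex (polyh G f)"
    using polyhedron_polyh[OF assms(1), of f]
    by (simp add: full_closed_convex_def polyhedron_imp_closed polyhedron_imp_convex)
  moreover have "\<not> int_vec z" if "z \<in> interior (polyh G f)" for z
    using that free[of z] by (force simp: interior_polyh assms(1))
  ultimately show ?thesis
    using card_facets_polyh[OF assms(1), of f] assms polyhedron_polyh[OF assms(1), of f]
    by (auto simp: Lfam_def lattice_free_def)
qed

text \<open>One normalised inequality per facet suffices. The segment from \<open>f\<close> to a
  point \<open>y\<close> outside \<open>B\<close> meets the frontier in some facet, where the
  inequality is already tight; if it still holds at \<open>y\<close>, the meeting point is
  \<open>y\<close> itself, against closedness.\<close>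

lemma polyhedron_eq_polyh:
  fixes B :: "(real^'n) set"
  assumes B: "polyhedron B" and f: "f \<in> interior B"
  obtains G where "finite G" "card G \<le> card {c. c facet_of B}" "B = polyh G f"
proof -
  have cB: "closed B" "convex B" using B polyhedron_imp_closed polyhedron_imp_convex by auto
  have fB: "f \<in> B" using f interior_subset by blast
  have "\<exists>g. B \<subseteq> {x. g \<bullet> (x - f) \<le> 1} \<and> c \<subseteq> {x. g \<bullet> (x - f) = 1}" if c: "c facet_of B" for c
  proof -
    obtain a b where ab: "a \<noteq> 0" "B \<subseteq> {x. a \<bullet> x \<le> b}" "c = B \<inter> {x. a \<bullet> x = b}"
      using facet_of_polyhedron[OF B c] by metis
    have "f \<in> interior {x. a \<bullet> x \<le> b}" using f ab(2) interior_mono by blast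
    then have lt: "a \<bullet> f < b" using ab(1) by simp
    then have "a \<bullet> (x - f) / (b - a \<bullet> f) \<le> 1 \<longleftrightarrow> a \<bullet> x \<le> b"
      "a \<bullet> (x - f) / (b - a \<bullet> f) = 1 \<longleftrightarrow> a \<bullet> x = b" for x
      by (auto simp: inner_diff_right divide_le_eq_1 divide_eq_1_iff)
    then show ?thesis
      using ab by (intro exI[of _ "(1 / (b - a \<bullet> f)) *\<^sub>R a"]) auto
  qed
  then obtain g where g: "\<And>c. c facet_of B \<Longrightarrow> B \<subseteq> {x. g c \<bullet> (x - f) \<le> 1} \<and> c \<subseteq> {x. g c \<bullet> (x - f) = 1}"
    by metis
  let ?G = "g ` {c. c facet_of B}"
  have fin: "finite {c. c facet_of B}" using B by (rule finite_polyhedron_facets)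
  have "polyh ?G f \<subseteq> B"
  proof (rule ccontr)
    assume "\<not> polyh ?G f \<subseteq> B"
    then obtain y where y: "y \<in> polyh ?G f" "y \<notin> B" by blast
    have "closed_segment f y \<inter> frontier B \<noteq> {}"
      by (rule connected_Int_frontier) (use y fB in auto)
    then obtain z where z: "z \<in> closed_segment f y" "z \<in> frontier B" by blast
    have "rel_frontier B = frontier B" using f by (intro rel_frontier_nonempty_interior) auto
    then obtain c where c: "c facet_of B" "z \<in> c" using rel_frontier_of_polyhedron[OF B] z by auto
    then have gz: "g c \<bullet> (z - f) = 1" using g by blast
    obtain t where t: "0 \<le> t" "t \<le> 1" "z = (1 - t) *\<^sub>R f + t *\<^sub>R y"
      using z(1) by (auto simp: in_segment)
    have "z - f = t *\<^sub>R (y - f)" using t(3) by (simp add: algebra_simps)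
    then have "t * (g c \<bullet> (y - f)) = 1" using gz by simp
    moreover have "g c \<bullet> (y - f) \<le> 1" using y(1) c(1) by (auto simp: polyh_def)
    ultimately have "t = 1" using t by (smt (verit) mult_left_le mult_le_0_iff)
    then have "z = y" using t by simp
    then show False using z(2) y(2) cB(1) by (simp add: frontier_def)
  qed
  moreover have "B \<subseteq> polyh ?G f" using g by (auto simp: polyh_def)
  ultimately show thesis using that[of ?G] fin card_image_le by blast
qed

section \<open>The gauge\<close>

lemma gauge_alt:
  "gauge ((\<lambda>x. x - f) ` B) r = Inf {t. t > 0 \<and> f + (1/t) *\<^sub>R r \<in> B}"
proof -
  have "{t. t > 0 \<and> r \<in> (\<lambda>x. t *\<^sub>R x) ` (\<lambda>x. x - f) ` B} = {t. t > 0 \<and> f + (1/t) *\<^sub>R r \<in> B}"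
  proof safe
    fix t :: real and x
    assume "0 < t" "x \<in> B"
    then show "f + (1 / t) *\<^sub>R t *\<^sub>R (x - f) \<in> B" by simp
  next
    fix t :: real
    assume "0 < t" "f + (1 / t) *\<^sub>R r \<in> B"
    then show "r \<in> (*\<^sub>R) t ` (\<lambda>x. x - f) ` B"
      by (auto simp: image_image intro!: image_eqI[of _ _ "f + (1 / t) *\<^sub>R r"])
  qed
  then show ?thesis by (simp add: gauge_def)
qed

lemma gauge_le:
  assumes "t > 0" "f + (1/t) *\<^sub>R r \<in> B"
  shows "gauge ((\<lambda>x. x - f) ` B) r \<le> t"
  unfolding gauge_alt using assms by (intro cInf_lower) (auto intro!: bdd_belowI[of _ 0])

text \<open>A lower bound for \<open>Inf\<close> requires a nonempty set; a ball around the interior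
  point \<open>f\<close> supplies a member.\<close>

lemma gauge_ge:
  assumes f: "f \<in> interior B"
    and le: "\<And>t. t > 0 \<Longrightarrow> f + (1/t) *\<^sub>R r \<in> B \<Longrightarrow> c \<le> t"
  shows "c \<le> gauge ((\<lambda>x. x - f) ` B) r"
  unfolding gauge_alt
proof (rule cInf_greatest)
  obtain e where e: "e > 0" "ball f e \<subseteq> B" using f mem_interior by blast
  define t where "t = (norm r + 1) / e"
  have "t > 0" using e by (simp add: t_def add_nonneg_pos)
  moreover have "f + (1/t) *\<^sub>R r \<in> ball f e"
  proof -
    have "norm r * e < e * (norm r + 1)" using e(1) by (simp add: algebra_simps)
    then have "norm ((1/t) *\<^sub>R r) < e"
      using e(1) by (simp add: t_def divide_simps add_nonneg_pos)
    then show ?thesis by (simp add: dist_norm)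
  qed
  ultimately show "{t. 0 < t \<and> f + (1 / t) *\<^sub>R r \<in> B} \<noteq> {}" using e by blast
qed (use le in auto)

lemma gauge_nonneg:
  "f \<in> interior B \<Longrightarrow> 0 \<le> gauge ((\<lambda>x. x - f) ` B) r"
  by (rule gauge_ge) auto

lemma gauge_scaled_le:
  assumes f: "f \<in> interior B" and a: "a > 0"
    and sub: "\<And>x. f + x \<in> B \<Longrightarrow> f + (1/a) *\<^sub>R x \<in> B'"
  shows "gauge ((\<lambda>x. x - f) ` B') r \<le> a * gauge ((\<lambda>x. x - f) ` B) r"
proof -
  have "gauge ((\<lambda>x. x - f) ` B') r / a \<le> gauge ((\<lambda>x. x - f) ` B) r"
  proof (rule gauge_ge[OF f])
    fix t :: real assume t: "t > 0" "f + (1/t) *\<^sub>R r \<in> B"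
    have "f + (1/(a*t)) *\<^sub>R r \<in> B'" using sub[OF t(2)] by simp
    then have "gauge ((\<lambda>x. x - f) ` B') r \<le> a * t" using a t by (intro gauge_le) auto
    then show "gauge ((\<lambda>x. x - f) ` B') r / a \<le> t" using a by (simp add: field_simps)
  qed
  then show ?thesis using a by (simp add: field_simps)
qed

section \<open>Approximation by \<open>n + 1\<close> facets\<close>

text \<open>One-dimensional Hahn-Banach step. Points with \<open>u > 0\<close> bound
  \<open>c\<close> from above, points with \<open>u < 0\<close> from below; the segment joining two
  such points crosses the hyperplane, where \<open>le\<close> makes the bounds compatible.
  \<open>p\<close> and \<open>q\<close> keep both families nonempty.\<close>

lemma hyperplane_bound_extension:
  fixes C :: "'a::real_inner set"
  assumes C: "convex C"
    and le: "\<And>x. x \<in> C \<Longrightarrow> u \<bullet> x = 0 \<Longrightarrow> g \<bullet> x \<le> A"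
    and p: "p \<in> C" "u \<bullet> p > 0" and q: "q \<in> C" "u \<bullet> q < 0"
  shows "\<exists>c. \<forall>x\<in>C. (g + c *\<^sub>R u) \<bullet> x \<le> A"
proof -
  define c where "c = Inf {(A - g \<bullet> x) / (u \<bullet> x) | x. x \<in> C \<and> u \<bullet> x > 0}"
  have key: "(g \<bullet> y - A) / (- (u \<bullet> y)) \<le> (A - g \<bullet> x) / (u \<bullet> x)"
    if x: "x \<in> C" "u \<bullet> x > 0" and y: "y \<in> C" "u \<bullet> y < 0" for x y
  proof -
    let ?D = "u \<bullet> x - u \<bullet> y"
    define z where "z = (- (u \<bullet> y) / ?D) *\<^sub>R x + (u \<bullet> x / ?D) *\<^sub>R y"
    have D: "?D > 0" using x y by simp
    have "z \<in> C" unfolding z_def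
      by (rule convexD[OF C x(1) y(1)]) (use x y D in \<open>auto simp: divide_nonpos_pos diff_divide_distrib[symmetric]\<close>)
    moreover have "u \<bullet> z = 0" using D by (simp add: z_def inner_add_right inner_diff_right)
    ultimately have "g \<bullet> z \<le> A" by (rule le)
    then have "g \<bullet> z * ?D \<le> A * ?D" using D by simp
    moreover have "g \<bullet> z * ?D = - (u \<bullet> y) * (g \<bullet> x) + u \<bullet> x * (g \<bullet> y)"
      using D by (simp add: z_def inner_add_right inner_diff_right distrib_right left_diff_distrib)
    ultimately show ?thesis using x y by (simp add: field_simps)
  qed
  have "(g + c *\<^sub>R u) \<bullet> x \<le> A" if x: "x \<in> C" for x
  proof (cases "u \<bullet> x" "0::real" rule: linorder_cases)
    case less
    have "(g \<bullet> x - A) / (- (u \<bullet> x)) \<le> c"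
      unfolding c_def by (rule cInf_greatest) (use key[OF _ _ x less] p in auto)
    then show ?thesis using less by (simp add: inner_add_left field_simps)
  next
    case equal
    then show ?thesis using le[OF x] by (simp add: inner_add_left)
  next
    case greater
    have "c \<le> (A - g \<bullet> x) / (u \<bullet> x)"
      unfolding c_def
      by (rule cInf_lower) (use x greater key[OF _ _ q] in \<open>auto intro!: bdd_belowI[of _ "(g \<bullet> q - A) / (- (u \<bullet> q))"]\<close>)
    then show ?thesis using greater by (simp add: inner_add_left field_simps)
  qed
  then show ?thesis by blast
qed

lemma exists_small_multiples_in:
  fixes K :: "'a::real_normed_vector set"
  assumes "0 \<in> interior K"
  obtains e where "e > 0" "e *\<^sub>R y \<in> K" "- (e *\<^sub>R y) \<in> K"
proof -
  obtain r where r: "r > 0" "ball 0 r \<subseteq> K" using assms mem_interior by blast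
  define e where "e = r / (norm y + 1)"
  have n: "norm y + 1 > 0" by (simp add: add_nonneg_pos)
  have "e > 0" using r n by (simp add: e_def)
  moreover have "norm (e *\<^sub>R y) < r"
    using r n \<open>e > 0\<close> by (simp add: e_def field_simps)
  ultimately show thesis using r by (intro that[of e]) (auto simp: mem_ball_0)
qed

text \<open>The cylinder over a slice through \<open>f\<close> of a lattice-free body, taken along the kernel of an
  integral projection, is again lattice-free, so a direction in which it is thin must be constant
  on the kernel. This is how one flatness bound in the full space serves all lower dimensions.\<close>

lemma narrow_direction:
  fixes f :: "real^'n"
  assumes K: "convex K" "closed K" "0 \<in> interior K"
    and free: "\<And>z. int_vec z \<Longrightarrow> z - f \<notin> interior K"
    and W: "Flt TYPE('n) < ereal W"
    and P: "linear P" "\<And>x. P (P x) = P x" "\<And>z. int_vec z \<Longrightarrow> int_vec (P z)"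
    and z0: "int_vec z0" "P (z0 - f) = z0 - f"
  obtains u y where "int_vec u" "P y = y" "int_vec y" "u \<bullet> y = 1" "\<And>x. u \<bullet> P x = u \<bullet> x"
    "\<And>x. x \<in> K \<Longrightarrow> P x = x \<Longrightarrow> \<bar>u \<bullet> x\<bar> < W"
proof -
  \<comment> \<open>\<open>h x + f\<close> is the affine projection of \<open>x\<close> onto
    \<open>f + range P\<close>; written with the integral base point \<open>z0\<close>, it visibly
    maps integer points to integer points.\<close>
  define h where "h = (\<lambda>x. z0 + P (x - z0) - f)"
  define D where "D = h -` K"
  interpret linear P by (rule P(1))
  have hf: "h f = 0" using z0(2) by (simp add: h_def diff algebra_simps)
  have conth: "continuous_on UNIV h"
    unfolding h_def by (intro continuous_intros linear_continuous_on_compose[OF _ P(1)])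
  have hadd: "h (x + y) = h x + P y" for x y by (simp add: h_def add diff algebra_simps)
  have hconv: "h (a *\<^sub>R x + b *\<^sub>R y) = a *\<^sub>R h x + b *\<^sub>R h y" if "a + b = 1" for a b x y
  proof -
    have "b = 1 - a" using that by simp
    then show ?thesis unfolding \<open>b = 1 - a\<close> by (simp add: h_def add diff scale algebra_simps)
  qed
  have ho: "open (h -` interior K)" using conth by (intro open_vimage) auto
  have fD: "f \<in> interior D"
    using hf K(3) interior_subset[of K]
    by (intro interiorI[OF ho]) (auto simp: D_def)
  have "closed D" unfolding D_def using K(2) conth by (intro closed_vimage) auto
  moreover have "convex D" unfolding convex_def D_def
    using hconv convexD[OF K(1)] by simp
  moreover have "aff_dim D = int CARD('n)" using aff_dim_nonempty_interior[of D] fD by auto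
  moreover have "\<not> int_vec z" if z: "z \<in> interior D" for z
  proof
    assume iz: "int_vec z"
    have "P (h z) = h z" using z0(2) by (simp add: h_def diff P(2) add algebra_simps)
    \<comment> \<open>Openness leaves room beyond \<open>z\<close> in direction \<open>h z\<close>,
      so \<open>(1 + t) h z\<close> lies in \<open>K\<close>; shrinking towards the interior point 0
      moves \<open>h z\<close> into the interior.\<close>
    have "continuous (at_right 0) (\<lambda>t::real. z + t *\<^sub>R h z)" by (intro continuous_intros)
    then have "((\<lambda>t::real. z + t *\<^sub>R h z) \<longlongrightarrow> z) (at_right 0)" by (simp add: continuous_within)
    then have "eventually (\<lambda>t::real. z + t *\<^sub>R h z \<in> interior D) (at_right 0)"
      using z by (auto dest!: topological_tendstoD[where S = "interior D"])
    then have ev: "eventually (\<lambda>t::real. t > 0 \<and> z + t *\<^sub>R h z \<in> interior D) (at_right 0)"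
      using eventually_at_right_less[of "0::real"] by eventually_elim auto
    obtain t :: real where t: "t > 0" "z + t *\<^sub>R h z \<in> interior D"
      using eventually_happens'[OF trivial_limit_at_right_real ev] by blast
    then have "h (z + t *\<^sub>R h z) \<in> K" using interior_subset D_def by blast
    then have k: "(1 + t) *\<^sub>R h z \<in> K" using \<open>P (h z) = h z\<close> by (simp add: hadd scale algebra_simps)
    have "(1 + t) *\<^sub>R h z - (t / (1 + t)) *\<^sub>R ((1 + t) *\<^sub>R h z - 0) \<in> interior K"
      by (rule mem_interior_convex_shrink[OF K(1,3) k]) (use t(1) in auto)
    moreover have "(1 + t) *\<^sub>R h z - (t / (1 + t)) *\<^sub>R ((1 + t) *\<^sub>R h z - 0) = h z"
    proof -
      have "t / (1 + t) * (1 + t) = t" using t(1) by simp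
      then show ?thesis by (simp only: scaleR_scaleR diff_zero) (simp add: scaleR_left_distrib)
    qed
    ultimately have "z0 + P (z - z0) - f \<in> interior K" by (simp add: h_def)
    then show False using free[of "z0 + P (z - z0)"] iz z0(1) P(3)
      by (auto intro: int_vec_add int_vec_diff)
  qed
  ultimately have "lattice_free D" by (simp add: lattice_free_def full_closed_convex_def)
  then have "lattice_width D \<le> Flt TYPE('n)" unfolding Flt_def by (intro SUP_upper) simp
  then have "lattice_width D < ereal W" using W by simp
  then obtain u where u: "int_vec u" "u \<noteq> 0"
    and w: "(SUP x\<in>D. ereal (u \<bullet> x)) - (INF x\<in>D. ereal (u \<bullet> x)) < ereal W"
    by (auto simp: lattice_width_def INF_less_iff)
  have wid: "u \<bullet> x - u \<bullet> x' < W" if "x \<in> D" "x' \<in> D" for x x'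
  proof -
    have "ereal (u \<bullet> x - u \<bullet> x') = ereal (u \<bullet> x) - ereal (u \<bullet> x')" by simp
    also have "\<dots> \<le> (SUP x\<in>D. ereal (u \<bullet> x)) - (INF x\<in>D. ereal (u \<bullet> x))"
      using that by (intro ereal_minus_mono SUP_upper INF_lower)
    also have "\<dots> < ereal W" by (rule w)
    finally show ?thesis by simp
  qed
  have fD': "f \<in> D" using fD interior_subset by blast
  \<comment> \<open>\<open>D\<close> is invariant along the kernel of \<open>P\<close>; if
    \<open>u\<close> were nonzero there, a kernel vector would change \<open>u\<close> by exactly
    \<open>W\<close>, more than the width allows.\<close>
  have ker: "u \<bullet> x = 0" if "P x = 0" for x
  proof (rule ccontr)
    assume n: "u \<bullet> x \<noteq> 0"
    have "f + (W / (u \<bullet> x)) *\<^sub>R x \<in> D" using fD' that by (simp add: D_def hadd scale)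
    then show False using wid[OF _ fD'] n by (force simp: inner_add_right)
  qed
  have uP: "u \<bullet> P x = u \<bullet> x" for x using ker[of "x - P x"] by (simp add: diff P(2) inner_diff_right)
  have bnd: "\<bar>u \<bullet> x\<bar> < W" if "x \<in> K" "P x = x" for x
  proof -
    have "f + x \<in> D" using that by (simp add: D_def hadd hf)
    then show ?thesis using wid[OF _ fD'] wid[OF fD'] by (force simp: inner_add_right abs_less_iff)
  qed
  \<comment> \<open>Dividing by \<open>g \<ge> 1\<close> only shrinks widths and provides a vector
    of value 1, which \<open>P\<close> moves into its range without changing that value.\<close>
  obtain g u' y where g: "g \<ge> (1::real)" "int_vec u'" "int_vec y" "u = g *\<^sub>R u'" "u' \<bullet> y = 1"
    using int_vec_primitive[OF u] by blast
  have u'P: "u' \<bullet> P x = u' \<bullet> x" for x using uP[of x] g by simp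
  show thesis
  proof (rule that[of u' "P y"])
    show "u' \<bullet> P y = 1" using u'P g by simp
    fix x assume "x \<in> K" "P x = x"
    then have "g * \<bar>u' \<bullet> x\<bar> < W" using bnd[of x] g by (simp add: abs_mult)
    moreover have "1 * \<bar>u' \<bullet> x\<bar> \<le> g * \<bar>u' \<bullet> x\<bar>" using g by (intro mult_right_mono) auto
    ultimately show "\<bar>u' \<bullet> x\<bar> < W" by simp
  qed (use g P u'P in auto)
qed

lemma Ints_abs_ge_1: "(x::real) \<in> \<int> \<Longrightarrow> x \<noteq> 0 \<Longrightarrow> \<bar>x\<bar> \<ge> 1"
  by (auto elim!: Ints_cases)

text \<open>\<open>P\<close> is an integral idempotent encoding the subspace. The balance under the
  convex weights \<open>lam\<close> is carried for the induction: it makes the weighted sum of the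
  lifted functionals a multiple of the new direction, so that one further functional excludes all
  integer points off the slice.\<close>

lemma approximating_simplex:
  fixes f :: "real^'n" and s :: nat
  assumes K: "convex K" "closed K" "0 \<in> interior K"
    and free: "\<And>z. int_vec z \<Longrightarrow> z - f \<notin> interior K"
    and W: "Flt TYPE('n) < ereal W" "W > 0"
    and s: "s > 0" "int_vec (real s *\<^sub>R f)" and f: "\<not> int_vec f"
    and P: "linear P" "\<And>x. P (P x) = P x" "\<And>z. int_vec z \<Longrightarrow> int_vec (P z)"
    and d: "dim (range P) \<le> d"
  shows "\<exists>g lam. (\<forall>j\<le>d. 0 \<le> lam j) \<and> (\<Sum>j\<le>d. lam j) = 1
    \<and> (\<forall>x. P x = x \<longrightarrow> (\<Sum>j\<le>d. lam j * (g j \<bullet> x)) = 0)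
    \<and> (\<forall>j\<le>d. \<forall>x\<in>K. P x = x \<longrightarrow> g j \<bullet> x \<le> real d * (W * s))
    \<and> (\<forall>z. int_vec z \<longrightarrow> P (z - f) = z - f \<longrightarrow> (\<exists>j\<le>d. g j \<bullet> (z - f) \<ge> 1))"
  using P d
proof (induction d arbitrary: P)
  case d: 0
  then have "range P = {0}" using linear_0[OF d(1)] by (auto simp: dim_eq_0)
  then have P0: "P x = 0" for x by auto
  \<comment> \<open>With \<open>P = 0\<close> the slice is the point \<open>f\<close> alone, which
    is not integral.\<close>
  show ?case
  proof (intro exI[of _ "\<lambda>_. 0 :: real^'n"] exI[of _ "\<lambda>_. 1 :: real"] conjI)
    show "\<forall>z. int_vec z \<longrightarrow> P (z - f) = z - f \<longrightarrow> (\<exists>j\<le>0. 1 \<le> 0 \<bullet> (z - f))"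
      using f P0 by auto
  qed auto
next
  case (Suc d)
  note P = Suc.prems(1-3)
  interpret P: linear P by (rule P(1))
  have Ws: "W \<le> W * s" "W * s \<ge> 0" using W(2) s(1) by simp_all
  show ?case
  proof (cases "\<exists>z. int_vec z \<and> P (z - f) = z - f")
    \<comment> \<open>The slice holds no integer point, so zero functionals suffice, with all weight
      on index 0.\<close>
    case False
    have "(\<Sum>j\<le>Suc d. if j = 0 then 1 else 0::real) = 1" by (simp add: sum.delta)
    then show ?thesis
      using False Ws by (intro exI[of _ "\<lambda>_. 0 :: real^'n"] exI[of _ "\<lambda>j. if j = 0 then 1 else 0"] conjI) auto
  next
    case True
    then obtain z0 where z0: "int_vec z0" "P (z0 - f) = z0 - f" by blast
    obtain u y where u: "int_vec u" "P y = y" "int_vec y" "u \<bullet> y = 1" "\<And>x. u \<bullet> P x = u \<bullet> x"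
      "\<And>x. x \<in> K \<Longrightarrow> P x = x \<Longrightarrow> \<bar>u \<bullet> x\<bar> < W"
      using narrow_direction[OF K free W(1) P z0] by metis
    show ?thesis
    proof (cases "u \<bullet> f \<in> \<int>")
      case False
      \<comment> \<open>Split: the distances from \<open>u \<bullet> f\<close> to the neighbouring
        integers sum to 1 and serve as weights for \<open>u / \<tau>\<close> and
        \<open>- u / \<tau>'\<close>. Integrality of \<open>s f\<close> makes both at least
        \<open>1 / s\<close>, the source of the factor \<open>s\<close> in the bound.\<close>
      define \<tau> where "\<tau> = \<lceil>u \<bullet> f\<rceil> - u \<bullet> f"
      define \<tau>' where "\<tau>' = u \<bullet> f - \<lfloor>u \<bullet> f\<rfloor>"
      have t1: "\<tau> + \<tau>' = 1" using False by (simp add: \<tau>_def \<tau>'_def ceiling_altdef) (metis Ints_of_int)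
      have pos: "\<tau> > 0" "\<tau>' > 0" using False
        by (simp_all add: \<tau>_def \<tau>'_def) (metis Ints_of_int ceiling_correct floor_correct order_le_less)+
      have sf: "s * (u \<bullet> f) \<in> \<int>" using int_vec_inner[OF u(1) s(2)] by simp
      have "s * \<tau> \<in> \<int>" "s * \<tau>' \<in> \<int>"
        using sf by (auto simp: \<tau>_def \<tau>'_def right_diff_distrib)
      then have ge: "s * \<tau> \<ge> 1" "s * \<tau>' \<ge> 1" using pos s(1) Ints_abs_ge_1 by force+
      define lam where "lam = (\<lambda>j::nat. if j = 0 then \<tau> else if j = 1 then \<tau>' else 0)"
      define g where "g = (\<lambda>j::nat. if j = 0 then (1/\<tau>) *\<^sub>R u else if j = 1 then - (1/\<tau>') *\<^sub>R u else 0)"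
      have sum2: "(\<Sum>j\<le>Suc d. c j) = c 0 + c 1" if "\<And>j. j > 1 \<Longrightarrow> c j = 0" for c :: "nat \<Rightarrow> real"
      proof -
        have "(\<Sum>j\<le>Suc d. c j) = (\<Sum>j\<in>{0,1}. c j)"
          using that by (intro sum.mono_neutral_right) auto
        then show ?thesis by simp
      qed
      have bd: "v / \<sigma> \<le> W * s" if "v < W" "\<sigma> > 0" "s * \<sigma> \<ge> 1" for v \<sigma> :: real
      proof -
        have "W * 1 \<le> W * (s * \<sigma>)" using that(3) W(2) by (intro mult_left_mono) auto
        then have "v \<le> W * s * \<sigma>" using that(1) by (simp add: algebra_simps)
        then show ?thesis using that(2) by (simp add: field_simps)
      qed
      have bd': "g j \<bullet> x \<le> W * s" if "x \<in> K" "P x = x" for j x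
        using bd[of "u \<bullet> x" \<tau>] bd[of "- (u \<bullet> x)" \<tau>'] u(6)[OF that] pos ge Ws
        by (auto simp: g_def)
      have WS: "W * s \<le> real (Suc d) * (W * s)" using mult_right_mono[of 1 "real (Suc d)" "W * s"] Ws(2) by simp
      show ?thesis
      proof (intro exI[of _ g] exI[of _ lam] conjI allI impI ballI)
        show "(\<Sum>j\<le>Suc d. lam j) = 1" using t1 by (subst sum2) (auto simp: lam_def)
        show "(\<Sum>j\<le>Suc d. lam j * (g j \<bullet> x)) = 0" for x
          using pos by (subst sum2) (auto simp: lam_def g_def)
        show "0 \<le> lam j" for j using pos by (simp add: lam_def)
        show "g j \<bullet> x \<le> real (Suc d) * (W * s)" if "x \<in> K" "P x = x" for j x
          using bd'[OF that] WS by (rule order_trans)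
        show "\<exists>j\<le>Suc d. 1 \<le> g j \<bullet> (z - f)" if z: "int_vec z" for z
        proof (rule ccontr)
          assume "\<not> ?thesis"
          then have "g 0 \<bullet> (z - f) < 1" "g 1 \<bullet> (z - f) < 1" by (auto simp: not_le)
          then have "u \<bullet> (z - f) < \<tau>" "- (u \<bullet> (z - f)) < \<tau>'"
            using pos by (auto simp: g_def field_simps)
          then have "u \<bullet> z < \<lceil>u \<bullet> f\<rceil>" "\<lfloor>u \<bullet> f\<rfloor> < u \<bullet> z"
            by (auto simp: inner_diff_right \<tau>_def \<tau>'_def)
          moreover obtain k where "u \<bullet> z = of_int k" using int_vec_inner[OF u(1) z] Ints_cases by blast
          ultimately show False using ceiling_diff_floor_le_1[of "u \<bullet> f"] by simp
        qed
      qed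
    next
      case uf: True
      \<comment> \<open>Projects further, along \<open>y\<close>, into the kernel of
        \<open>u\<close>; \<open>y\<close> and the values of \<open>u\<close> on integer points are
        integral, hence so is the projection.\<close>
      define P' where "P' = (\<lambda>x. P x - (u \<bullet> x) *\<^sub>R y)"
      have lP': "linear P'"
        by (rule linearI) (simp_all add: P'_def P.add P.scale inner_add_right algebra_simps)
      have P'P: "P (P' x) = P' x" for x by (simp add: P'_def P.diff P.scale P u)
      have uP': "u \<bullet> P' x = 0" for x by (simp add: P'_def inner_diff_right u)
      have P'2: "P' (P' x) = P' x" for x using P'P[of x] uP'[of x] by (simp add: P'_def)
      have P'int: "int_vec (P' z)" if "int_vec z" for z
        unfolding P'_def using that by (intro int_vec_diff int_vec_scaleR P u int_vec_inner) 
      have P'iff: "P' x = x" if "P x = x" "u \<bullet> x = 0" for x using that by (simp add: P'_def)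
      have "range P' \<subset> range P"
      proof
        show "range P' \<subseteq> range P" using P'P by (metis image_subsetI rangeI)
        have "P' y \<noteq> y" using u by (auto simp: P'_def)
        then have "y \<notin> range P'" using P'2 by auto
        moreover have "y \<in> range P" using u(2) by (metis rangeI)
        ultimately show "range P' \<noteq> range P" by blast
      qed
      moreover have "subspace (range P)" "subspace (range P')"
        using P(1) lP' linear_subspace_image subspace_UNIV by blast+
      ultimately have "dim (range P') < dim (range P)"
        by (intro dim_psubset) (simp add: span_eq_iff[THEN iffD2])
      then have "dim (range P') \<le> d" using Suc.prems(4) by simp
      from Suc.IH[OF lP' P'2 P'int this] obtain g lam where
        lam: "\<And>j. j \<le> d \<Longrightarrow> 0 \<le> lam j" "(\<Sum>j\<le>d. lam j) = 1" and
        bal: "\<And>x. P' x = x \<Longrightarrow> (\<Sum>j\<le>d. lam j * (g j \<bullet> x)) = 0" and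
        gb: "\<And>j x. j \<le> d \<Longrightarrow> x \<in> K \<Longrightarrow> P' x = x \<Longrightarrow> g j \<bullet> x \<le> real d * (W * s)" and
        gz: "\<And>z. int_vec z \<Longrightarrow> P' (z - f) = z - f \<Longrightarrow> \<exists>j\<le>d. g j \<bullet> (z - f) \<ge> 1"
        by blast
      obtain e where e: "e > 0" "e *\<^sub>R y \<in> K" "- (e *\<^sub>R y) \<in> K"
        using exists_small_multiples_in[OF K(3)] by blast
      define C where "C = K \<inter> {x. P x = x}"
      have "convex C" unfolding C_def
        by (intro convex_Int K) (auto simp: convex_def P.add P.scale)
      \<comment> \<open>Adding a multiple of \<open>u\<close> leaves a functional unchanged on the
        slice \<open>u = 0\<close>; small multiples of \<open>y\<close> of both signs are the two
        side points.\<close>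
      have "\<exists>c. \<forall>x\<in>C. (g j + c *\<^sub>R u) \<bullet> x \<le> real d * (W * s)" if "j \<le> d" for j
        by (rule hyperplane_bound_extension[OF \<open>convex C\<close>, where p = "e *\<^sub>R y" and q = "- (e *\<^sub>R y)"])
          (use e gb[OF that] P'iff u in \<open>auto simp: C_def P.scale P.neg\<close>)
      then obtain c where c: "\<And>j x. j \<le> d \<Longrightarrow> x \<in> C \<Longrightarrow> (g j + c j *\<^sub>R u) \<bullet> x \<le> real d * (W * s)"
        by metis
      \<comment> \<open>By the inductive balance the weighted sum vanishes on \<open>u = 0\<close>,
        so on the range of \<open>P\<close> it is a multiple of \<open>u\<close>, with the factor
        read off at \<open>y\<close>.\<close>
      define m where "m = (\<Sum>j\<le>d. lam j * ((g j + c j *\<^sub>R u) \<bullet> y))"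
      have mx: "(\<Sum>j\<le>d. lam j * ((g j + c j *\<^sub>R u) \<bullet> x)) = m * (u \<bullet> x)" if "P x = x" for x
      proof -
        define x' where "x' = P' x"
        have "x = x' + (u \<bullet> x) *\<^sub>R y" using that by (simp add: x'_def P'_def)
        then have dec: "v \<bullet> x = v \<bullet> x' + (u \<bullet> x) * (v \<bullet> y)" for v
          by (metis inner_add_right inner_scaleR_right)
        have "lam j * ((g j + c j *\<^sub>R u) \<bullet> x)
            = lam j * (g j \<bullet> x') + lam j * ((g j + c j *\<^sub>R u) \<bullet> y) * (u \<bullet> x)" for j
          using dec[of "g j"] by (simp add: inner_add_left u algebra_simps)
        then show ?thesis using bal[of x'] P'2 by (simp add: sum.distrib m_def sum_distrib_right x'_def)
      qed
      text \<open>Tilting all constraints by \<open>\<plusminus>u\<close> costs only the width of the slice, and makes them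
        exclude every integer point lying at integer distance at least 1 on one side of the slice.\<close>
      define \<epsilon> :: real where "\<epsilon> = (if m \<ge> 0 then 1 else -1)"
      \<comment> \<open>The sign of \<open>\<epsilon>\<close> follows that of \<open>m\<close>, so
        nothing cancels and \<open>a = |m| + 1\<close>.\<close>
      define a where "a = \<bar>m + \<epsilon>\<bar>"
      have a: "a \<ge> 1" "m + \<epsilon> = \<epsilon> * a" by (auto simp: a_def \<epsilon>_def)
      define G where "G = (\<lambda>j. if j \<le> d then g j + c j *\<^sub>R u + \<epsilon> *\<^sub>R u else - \<epsilon> *\<^sub>R u)"
      \<comment> \<open>Under \<open>lam\<close> the tilted functionals sum to
        \<open>\<epsilon> a u\<close>; relative weight \<open>a\<close> on the last one,
        \<open>- \<epsilon> u\<close>, restores the balance, and \<open>1 + a\<close>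
        normalises.\<close>
      define lam' where "lam' = (\<lambda>j. if j \<le> d then lam j / (1 + a) else a / (1 + a))"
      have Gx: "(\<Sum>j\<le>d. lam j * (G j \<bullet> x)) = \<epsilon> * a * (u \<bullet> x)" if "P x = x" for x
      proof -
        have "(\<Sum>j\<le>d. lam j * (G j \<bullet> x)) =
            (\<Sum>j\<le>d. lam j * ((g j + c j *\<^sub>R u) \<bullet> x) + lam j * (\<epsilon> * (u \<bullet> x)))"
          by (rule sum.cong) (auto simp: G_def inner_add_left algebra_simps)
        also have "\<dots> = m * (u \<bullet> x) + \<epsilon> * (u \<bullet> x)"
          using mx[OF that] lam(2) by (simp add: sum.distrib sum_distrib_right[symmetric])
        also have "\<dots> = (m + \<epsilon>) * (u \<bullet> x)" by (simp add: algebra_simps)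
        finally show ?thesis using a(2) by simp
      qed
      have \<epsilon>W: "\<epsilon> * v < W" "- (\<epsilon> * v) < W" if "\<bar>v\<bar> < W" for v using that by (auto simp: \<epsilon>_def)
      show ?thesis
      proof (intro exI[of _ G] exI[of _ lam'] conjI allI impI ballI)
        show "0 \<le> lam' j" for j using lam(1)[of j] a(1) by (simp add: lam'_def)
        have "(\<Sum>j\<le>d. lam' j) = (\<Sum>j\<le>d. lam j) / (1 + a)"
          by (simp add: lam'_def sum_divide_distrib)
        then show "(\<Sum>j\<le>Suc d. lam' j) = 1" using lam(2) a(1) by (simp add: lam'_def field_simps)
        show "(\<Sum>j\<le>Suc d. lam' j * (G j \<bullet> x)) = 0" if "P x = x" for x
        proof -
          have "(\<Sum>j\<le>d. lam' j * (G j \<bullet> x)) = (\<Sum>j\<le>d. lam j * (G j \<bullet> x)) / (1 + a)"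
            by (simp add: lam'_def sum_divide_distrib)
          then show ?thesis using Gx[OF that] a(1) by (simp add: lam'_def G_def field_simps)
        qed
        show "G j \<bullet> x \<le> real (Suc d) * (W * s)" if "x \<in> K" "P x = x" for j x
        proof (cases "j \<le> d")
          case True
          have "(g j + c j *\<^sub>R u) \<bullet> x \<le> real d * (W * s)" using c[OF True] that by (simp add: C_def)
          moreover have "\<epsilon> * (u \<bullet> x) \<le> W * s" using \<epsilon>W[OF u(6)[OF that]] Ws by linarith
          ultimately show ?thesis using True by (simp add: G_def inner_add_left algebra_simps)
        next
          case False
          have "- (\<epsilon> * (u \<bullet> x)) \<le> W * s" using \<epsilon>W[OF u(6)[OF that]] Ws by linarith
          moreover have "W * s \<le> real (Suc d) * (W * s)" using mult_right_mono[of 1 "real (Suc d)" "W * s"] Ws(2) by simp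
          ultimately show ?thesis using False by (simp add: G_def)
        qed
        show "\<exists>j\<le>Suc d. 1 \<le> G j \<bullet> (z - f)" if z: "int_vec z" "P (z - f) = z - f" for z
        proof (rule ccontr)
          assume "\<not> ?thesis"
          then have lt: "G j \<bullet> (z - f) < 1" if "j \<le> Suc d" for j using that by (meson not_le)
          \<comment> \<open>\<open>v\<close> is an integer since \<open>u \<bullet> f\<close> is.
            The last functional gives \<open>\<epsilon> v > -1\<close>, the average of the others
            \<open>a \<epsilon> v < 1\<close>; as \<open>a \<ge> 1\<close>, only
            \<open>v = 0\<close> remains, where tilting has no effect and the inductive functionals
            apply.\<close>
          define v where "v = u \<bullet> (z - f)"
          have vI: "v \<in> \<int>" using int_vec_inner[OF u(1) z(1)] uf by (simp add: v_def inner_diff_right)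
          have "\<epsilon> * v > -1" using lt[of "Suc d"] by (simp add: G_def v_def)
          \<comment> \<open>A positive weight makes the averaged inequality strict.\<close>
          have "\<exists>j\<le>d. lam j > 0"
          proof (rule ccontr)
            assume "\<not> ?thesis"
            then have "(\<Sum>j\<le>d. lam j) \<le> 0" by (intro sum_nonpos) (auto simp: not_less)
            then show False using lam(2) by simp
          qed
          then obtain j0 where j0: "j0 \<le> d" "lam j0 > 0" by blast
          have "(\<Sum>j\<le>d. lam j * (G j \<bullet> (z - f))) < (\<Sum>j\<le>d. lam j)"
          proof (rule sum_strict_mono_ex1)
            show "\<forall>j\<in>{..d}. lam j * (G j \<bullet> (z - f)) \<le> lam j"
              using lam(1) less_imp_le[OF lt] by (auto intro!: mult_left_le)
            show "\<exists>j\<in>{..d}. lam j * (G j \<bullet> (z - f)) < lam j"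
              using j0 lt[of j0] by (intro bexI[of _ j0]) auto
          qed simp
          then have av: "a * (\<epsilon> * v) < 1" using Gx[OF z(2)] lam(2) by (simp add: v_def algebra_simps)
          show False
          proof (cases "v = 0")
            case True
            then obtain j where "j \<le> d" "g j \<bullet> (z - f) \<ge> 1"
              using gz[OF z(1) P'iff[OF z(2)]] by (auto simp: v_def)
            then show False using lt[of j] True by (auto simp: G_def v_def inner_add_left)
          next
            case False
            then have "\<bar>v\<bar> \<ge> 1" using vI Ints_abs_ge_1 by blast
            then have "\<epsilon> * v \<ge> 1" using \<open>\<epsilon> * v > -1\<close> by (auto simp: \<epsilon>_def split: if_splits)
            then have "1 * 1 \<le> a * (\<epsilon> * v)" using a(1) by (intro mult_mono) auto
            then show False using av by simp
          qed
        qed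
      qed
    qed
  qed
qed

section \<open>Upper bound on \<open>rho\<close> from approximating bodies\<close>

lemma Lfam_mono: "i \<le> j \<Longrightarrow> Lfam i \<subseteq> Lfam j"
  by (auto simp: Lfam_def)

text \<open>The simplex construction with the identity as \<open>P\<close>: its \<open>n + 1\<close>
  functionals, bounded by \<open>n W s\<close> on \<open>B - f\<close>, are bounded by 1 after
  shrinking by \<open>a\<close>.\<close>

lemma Lfam_approximates_Lstar:
  fixes f :: "real^'n" and B :: "(real^'n) set"
  assumes B: "B \<in> Lstar" "f \<in> interior B" and f: "rat_vec f" "\<not> int_vec f"
    and W: "Flt TYPE('n) < ereal W" "W > 0"
    and a: "W * real CARD('n) * denom_vec f \<le> a"
  obtains B' where "B' \<in> Lfam (Suc CARD('n))" "f \<in> interior B'"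
    "\<And>x. f + x \<in> B \<Longrightarrow> f + (1/a) *\<^sub>R x \<in> B'"
proof -
  define K where "K = (+) (- f) ` B"
  have "closed B" "convex B" using B(1) by (auto simp: Lstar_def lattice_free_def full_closed_convex_def)
  then have "convex K" "closed K"
    using closed_translation[of B "- f"] convex_translation[of B "- f"] by (simp_all add: K_def)
  have iK: "interior K = (+) (- f) ` interior B" unfolding K_def by (rule interior_translation)
  have "0 \<in> interior K" using B(2) by (auto simp: iK image_iff)
  have free: "z - f \<notin> interior K" if "int_vec z" for z
    using B(1) that by (auto simp: iK Lstar_def lattice_free_def image_iff algebra_simps)
  let ?n = "CARD('n)"
  have "\<exists>g. (\<forall>j\<le>?n. \<forall>x\<in>K. g j \<bullet> x \<le> real ?n * (W * denom_vec f))
      \<and> (\<forall>z. int_vec z \<longrightarrow> (\<exists>j\<le>?n. g j \<bullet> (z - f) \<ge> 1))"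
    using approximating_simplex[OF \<open>convex K\<close> \<open>closed K\<close> \<open>0 \<in> interior K\<close> free W
        denom_vec_pos[OF f(1)] int_vec_denom_vec[OF f(1)] f(2), of "\<lambda>x. x" ?n]
    by (simp add: linear_id[unfolded id_def]) blast
  then obtain g where g: "\<And>j x. j \<le> ?n \<Longrightarrow> x \<in> K \<Longrightarrow> g j \<bullet> x \<le> real ?n * (W * denom_vec f)"
    and gz: "\<And>z. int_vec z \<Longrightarrow> \<exists>j\<le>?n. g j \<bullet> (z - f) \<ge> 1"
    by blast
  have "0 < W * real ?n * denom_vec f" using W(2) denom_vec_pos[OF f(1)] by simp
  then have a0: "a > 0" using a by simp
  show thesis
  proof (rule that[of "polyh (g ` {..?n}) f"])
    have "card (g ` {..?n}) \<le> Suc ?n" using card_image_le[of "{..?n}" g] by simp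
    then show "polyh (g ` {..?n}) f \<in> Lfam (Suc ?n)" by (rule polyh_in_Lfam[rotated]) (use gz in auto)
    show "f \<in> interior (polyh (g ` {..?n}) f)" by (simp add: interior_polyh)
    fix x assume "f + x \<in> B"
    then have "x \<in> K" by (force simp: K_def)
    then have "g j \<bullet> x \<le> a" if "j \<le> ?n" for j using g[OF that \<open>x \<in> K\<close>] a by (simp add: algebra_simps)
    then show "f + (1/a) *\<^sub>R x \<in> polyh (g ` {..?n}) f" using a0 by (auto simp: polyh_def)
  qed
qed

text \<open>If \<open>s\<close> satisfies the cuts of \<open>\<B>\<close>, then \<open>a s\<close>
  satisfies those of \<open>\<L>\<close>: the gauge of \<open>B'\<close> is at most \<open>a\<close>
  times that of \<open>B\<close>, and bodies without \<open>f\<close> in the interior impose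
  nothing.\<close>

lemma rho_le:
  assumes a: "a > 0"
    and approx: "\<And>B. B \<in> \<L> \<Longrightarrow> f \<in> interior B \<Longrightarrow>
      \<exists>B'\<in>\<B>. f \<in> interior B' \<and> (\<forall>x. f + x \<in> B \<longrightarrow> f + (1/a) *\<^sub>R x \<in> B')"
  shows "rho f \<B> \<L> \<le> ereal a"
  unfolding rho_def
proof (rule Inf_lower, rule CollectI, intro exI conjI allI)
  fix k and R :: "nat \<Rightarrow> real^'a"
  show "cut_fam \<B> k R f \<subseteq> (\<lambda>s j. s j / a) ` cut_fam \<L> k R f"
  proof
    fix s assume s: "s \<in> cut_fam \<B> k R f"
    define s' where "s' = (\<lambda>j. a * s j)"
    have so: "s \<in> orthant k" using s by (simp add: cut_fam_def)
    then have so': "s' \<in> orthant k" using a by (simp add: s'_def orthant_def)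
    have "s' \<in> cut_set B k R f" if B: "B \<in> \<L>" for B
    proof (cases "f \<in> interior B")
      case True
      then obtain B' where B': "B' \<in> \<B>" "f \<in> interior B'" "\<And>x. f + x \<in> B \<Longrightarrow> f + (1/a) *\<^sub>R x \<in> B'"
        using approx[OF B] by blast
      have "1 \<le> (\<Sum>j<k. s j * gauge ((\<lambda>x. x - f) ` B') (R j))"
        using s B'(1,2) by (auto simp: cut_fam_def cut_set_def)
      also have "\<dots> \<le> (\<Sum>j<k. s j * (a * gauge ((\<lambda>x. x - f) ` B) (R j)))"
        using so by (intro sum_mono mult_left_mono gauge_scaled_le True a B'(3)) (auto simp: orthant_def)
      also have "\<dots> = (\<Sum>j<k. s' j * gauge ((\<lambda>x. x - f) ` B) (R j))"
        by (simp add: s'_def algebra_simps)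
      finally show ?thesis using True so' by (simp add: cut_set_def)
    qed (use so' in \<open>simp add: cut_set_def\<close>)
    then have "s' \<in> cut_fam \<L> k R f" using so' by (simp add: cut_fam_def)
    moreover have "s = (\<lambda>j. s' j / a)" using a by (simp add: s'_def)
    ultimately show "s \<in> (\<lambda>s j. s j / a) ` cut_fam \<L> k R f" by blast
  qed
qed (use a in auto)

lemma lattice_width_nonneg: "X \<noteq> {} \<Longrightarrow> 0 \<le> lattice_width X"
  unfolding lattice_width_def
  by (intro INF_greatest)
    (metis (mono_tags, lifting) INF_lower2 SUP_upper ereal_diff_positive ex_in_conv le_cases order_trans)

text \<open>Rules out the value \<open>-\<infinity>\<close> of an empty supremum: the strip
  \<open>0 \<le> x $ j0 \<le> 1\<close> is a lattice-free body.\<close>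

lemma Flt_nonneg: "0 \<le> Flt TYPE('n::finite)"
proof -
  fix j0 :: 'n
  define f :: "real^'n" where "f = (1/2) *\<^sub>R axis j0 1"
  define G where "G = {2 *\<^sub>R axis j0 1, - 2 *\<^sub>R (axis j0 1 :: real^'n)}"
  have "polyh G f \<in> Lfam 2"
  proof (rule polyh_in_Lfam)
    show "card G \<le> 2" by (simp add: G_def card_insert_if)
    fix z :: "real^'n" assume "int_vec z"
    then obtain k where "z $ j0 = of_int k" by (auto simp: int_vec_def elim: Ints_cases)
    moreover have "k \<ge> 1 \<or> k \<le> 0" by linarith
    ultimately have "z $ j0 \<ge> 1 \<or> z $ j0 \<le> 0" by auto
    then show "\<exists>g\<in>G. g \<bullet> (z - f) \<ge> 1"
      by (auto simp: G_def f_def inner_axis' inner_axis algebra_simps)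
  qed (simp add: G_def)
  then have "lattice_free (polyh G f)" by (simp add: Lfam_def)
  moreover have "f \<in> polyh G f" by (simp add: polyh_def)
  ultimately show ?thesis
    unfolding Flt_def by (intro SUP_upper2[of "polyh G f"] lattice_width_nonneg) auto
qed

lemma rho_Lfam_Lstar_le:
  fixes f :: "real^'n"
  assumes i: "i > CARD('n)" and f: "rat_vec f" "\<not> int_vec f"
  shows "rho f (Lfam i) Lstar \<le> Flt TYPE('n) * ereal (4 ^ (CARD('n) - 1) * real (denom_vec f))"
proof (cases "Flt TYPE('n)")
  case (real F)
  let ?c = "4 ^ (CARD('n) - 1) * real (denom_vec f)"
  have c: "?c > 0" using denom_vec_pos[OF f(1)] by simp
  have F: "F \<ge> 0" using Flt_nonneg[where 'n='n] real by simp
  have "real (Suc m) \<le> 4 ^ m" for m by (induction m) auto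
  then have n4: "real CARD('n) \<le> 4 ^ (CARD('n) - 1)"
    by (metis Suc_pred' zero_less_card_finite)
  have W: "rho f (Lfam i) Lstar \<le> ereal (W * ?c)" if W: "W > F" for W
  proof (rule rho_le)
    have W0: "W > 0" using W F by simp
    then show "W * ?c > 0" using c by simp
    have a: "W * real CARD('n) * denom_vec f \<le> W * ?c"
      using n4 W0 by (simp add: mult.assoc mult_right_mono)
    fix B :: "(real^'n) set" assume B: "B \<in> Lstar" "f \<in> interior B"
    obtain B' where "B' \<in> Lfam (Suc CARD('n))" "f \<in> interior B'"
      "\<And>x. f + x \<in> B \<Longrightarrow> f + (1/(W * ?c)) *\<^sub>R x \<in> B'"
      using Lfam_approximates_Lstar[OF B f _ W0 a] W real by auto
    moreover have "Lfam (Suc CARD('n)) \<subseteq> (Lfam i :: (real^'n) set set)" using i by (intro Lfam_mono) simp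
    ultimately show "\<exists>B'\<in>Lfam i. f \<in> interior B' \<and> (\<forall>x. f + x \<in> B \<longrightarrow> f + (1/(W * ?c)) *\<^sub>R x \<in> B')"
      by blast
  qed
  have "rho f (Lfam i) Lstar \<le> ereal (F * ?c)"
  proof (rule ereal_le_epsilon2)
    fix e :: real assume "e > 0"
    then have "rho f (Lfam i) Lstar \<le> ereal ((F + e / ?c) * ?c)" using c by (intro W) simp
    also have "(F + e / ?c) * ?c = F * ?c + e"
      using denom_vec_pos[OF f(1)] by (simp add: distrib_right)
    finally show "rho f (Lfam i) Lstar \<le> ereal (F * ?c) + ereal e" by simp
  qed
  then show ?thesis by (simp add: real)
next
  case PInf
  then show ?thesis using denom_vec_pos[OF f(1)] by simp
next
  case MInf
  then show ?thesis using Flt_nonneg[where 'n='n] by simp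
qed

section \<open>Bodies that few facets cannot approximate\<close>

text \<open>Part of a lattice basis with its dual functionals: integer points have integer
  coordinates \<open>u j\<close>, and integer combinations of the \<open>b j\<close> are integer
  points.\<close>

definition dual_system :: "nat \<Rightarrow> (nat \<Rightarrow> real^'n) \<Rightarrow> (nat \<Rightarrow> real^'n) \<Rightarrow> bool" where
  "dual_system m u b \<longleftrightarrow>
    (\<forall>j<m. int_vec (u j) \<and> int_vec (b j) \<and> (\<forall>l<m. u j \<bullet> b l = (if j = l then 1 else 0)))"

lemma dual_systemD:
  assumes "dual_system m u b" "j < m"
  shows "int_vec (u j)" "int_vec (b j)" "l < m \<Longrightarrow> u j \<bullet> b l = (if j = l then 1 else 0)"
  using assms by (auto simp: dual_system_def)

text \<open>A unit vector outside the span of the \<open>u j\<close> is corrected to annihilate the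
  old \<open>b j\<close> and made primitive; a vector on which it takes value 1 is then corrected to
  be annihilated by the old \<open>u j\<close>.\<close>

lemma dual_system_extend:
  fixes u :: "nat \<Rightarrow> real^'n"
  assumes D: "dual_system m u b" and m: "m < CARD('n)"
  shows "\<exists>v w. dual_system (Suc m) (u(m := v)) (b(m := w))"
proof -
  note D' = dual_systemD[OF D]
  have "\<exists>l. axis l 1 \<notin> span (u ` {..<m})"
  proof (rule ccontr)
    assume "\<not> ?thesis"
    then have "Basis \<subseteq> span (u ` {..<m})" by (auto simp: Basis_vec_def)
    then have "span Basis \<subseteq> span (u ` {..<m})" by (intro span_minimal) auto
    then have "dim (UNIV :: (real^'n) set) \<le> dim (u ` {..<m})"
      by (metis dim_span dim_subset span_Basis)
    also have "\<dots> \<le> m" using dim_le_card'[of "u ` {..<m}"] card_image_le[of "{..<m}" u] by simp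
    finally show False using m by simp
  qed
  then obtain l where l: "axis l 1 \<notin> span (u ` {..<m})" ..
  define q where "q = axis l 1 - (\<Sum>j<m. (axis l 1 \<bullet> b j) *\<^sub>R u j)"
  have "q \<noteq> 0"
  proof
    assume "q = 0"
    then have "axis l 1 = (\<Sum>j<m. (axis l 1 \<bullet> b j) *\<^sub>R u j)" by (simp add: q_def)
    also have "\<dots> \<in> span (u ` {..<m})" by (intro span_sum span_scale span_base) auto
    finally show False using l by simp
  qed
  have "int_vec q" unfolding q_def
    by (intro int_vec_diff int_vec_sum int_vec_scaleR int_vec_inner) (auto simp: D')
  have qb: "q \<bullet> b k = 0" if "k < m" for k
  proof -
    have "(\<Sum>j<m. (axis l 1 \<bullet> b j) * (u j \<bullet> b k)) = (\<Sum>j<m. if j = k then axis l 1 \<bullet> b k else 0)"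
      by (rule sum.cong) (use that in \<open>auto simp: D'\<close>)
    then show ?thesis using that by (simp add: q_def inner_diff_left inner_sum_left)
  qed
  obtain g v y where v: "g \<ge> (1::real)" "int_vec v" "int_vec y" "q = g *\<^sub>R v" "v \<bullet> y = 1"
    using int_vec_primitive[OF \<open>int_vec q\<close> \<open>q \<noteq> 0\<close>] by blast
  have vb: "v \<bullet> b k = 0" if "k < m" for k using qb[OF that] v by simp
  define w where "w = y - (\<Sum>j<m. (u j \<bullet> y) *\<^sub>R b j)"
  have "int_vec w" unfolding w_def using v
    by (intro int_vec_diff int_vec_sum int_vec_scaleR int_vec_inner) (auto simp: D')
  have uw: "u k \<bullet> w = 0" if "k < m" for k
  proof -
    have "(\<Sum>j<m. (u j \<bullet> y) * (u k \<bullet> b j)) = (\<Sum>j<m. if j = k then u k \<bullet> y else 0)"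
      by (rule sum.cong) (use that in \<open>auto simp: D'\<close>)
    then show ?thesis using that by (simp add: w_def inner_diff_right inner_sum_right)
  qed
  have "v \<bullet> w = 1" using v vb by (simp add: w_def inner_diff_right inner_sum_right)
  then have "dual_system (Suc m) (u(m := v)) (b(m := w))"
    using v(2) \<open>int_vec w\<close> vb uw D by (auto simp: dual_system_def less_Suc_eq)
  then show ?thesis by blast
qed

lemma dual_system_adapted:
  fixes f :: "real^'n"
  assumes f: "rat_vec f" "\<not> int_vec f" and m: "Suc m \<le> CARD('n)"
  obtains u b t where "dual_system (Suc m) u b" "f = t *\<^sub>R b m" "t \<notin> \<int>"
proof -
  let ?s = "denom_vec f"
  have s: "?s > 0" "int_vec (real ?s *\<^sub>R f)" using denom_vec_pos int_vec_denom_vec f(1) by auto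
  have "f \<noteq> 0" using f(2) by auto
  then have "real ?s *\<^sub>R f \<noteq> 0" using s(1) by simp
  then obtain g v y where v: "int_vec v" "int_vec y" "real ?s *\<^sub>R f = g *\<^sub>R v" "v \<bullet> y = 1"
    using int_vec_primitive[OF s(2)] by metis
  define t where "t = g / ?s"
  have "f = (1 / ?s) *\<^sub>R (real ?s *\<^sub>R f)" using s(1) by simp
  also have "\<dots> = t *\<^sub>R v" unfolding v(3) by (simp add: t_def)
  finally have ft: "f = t *\<^sub>R v" .
  have "\<exists>u b. dual_system (Suc k) u b \<and> b 0 = v" if "Suc k \<le> CARD('n)" for k
    using that
  proof (induction k)
    case 0
    show ?case
      by (rule exI[of _ "\<lambda>_. y"], rule exI[of _ "\<lambda>_. v"])
        (use v in \<open>auto simp: dual_system_def inner_commute\<close>)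
  next
    case (Suc k)
    then obtain u b where ub: "dual_system (Suc k) u b" "b 0 = v" by auto
    obtain u' w where "dual_system (Suc (Suc k)) (u(Suc k := u')) (b(Suc k := w))"
      using dual_system_extend[OF ub(1)] Suc.prems by auto
    then show ?case using ub(2) by (metis fun_upd_other nat.distinct(1))
  qed
  then obtain u b where ub: "dual_system (Suc m) u b" "b 0 = v" using m by blast
  show thesis
  \<comment> \<open>Reversing the indices puts the direction of \<open>f\<close>, which started the
    system, at index \<open>m\<close>.\<close>
  proof (rule that[of "\<lambda>j. u (m - j)" "\<lambda>j. b (m - j)" t])
    show "dual_system (Suc m) (\<lambda>j. u (m - j)) (\<lambda>j. b (m - j))"
      unfolding dual_system_def using dual_systemD[OF ub(1)] by auto
    show "f = t *\<^sub>R b (m - m)" using ft ub(2) by simp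
    show "t \<notin> \<int>" using ft v(1) f(2) int_vec_scaleR by blast
  qed
qed

text \<open>For fixed \<open>j\<close>, letting \<open>l\<close> range over \<open>{j<..m}\<close>
  and \<open>e\<close> over both signs gives the vertices of a cross-polytope of radius
  \<open>\<rho>\<close> in the directions after \<open>j\<close>; these are the finitely many test
  rays.\<close>

definition ray :: "(nat \<Rightarrow> real^'n) \<Rightarrow> nat \<Rightarrow> real \<Rightarrow> nat \<Rightarrow> nat \<Rightarrow> real \<Rightarrow> real^'n" where
  "ray b m \<rho> j l e = b j + \<rho> *\<^sub>R (\<Sum>q\<in>{j<..<m}. b q) + (e * \<rho>) *\<^sub>R b l"

text \<open>In the coordinates \<open>u\<^sub>0, \<dots>, u\<^sub>m\<close> the body is an iterated pyramid: \<open>u\<^sub>q \<le> 1 + M (u\<^sub>0 + \<dots> + u\<^sub>q\<^sub>-\<^sub>1)\<close> for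
  \<open>q < m\<close>, closed by two facets through the integer points of the line \<open>\<real> b\<^sub>m\<close> next to \<open>f\<close>.\<close>

lemma iterated_pyramid:
  fixes f :: "real^'n"
  assumes D: "dual_system (Suc m) u b" and f: "f = t *\<^sub>R b m" and t: "t \<notin> \<int>" and \<rho>: "\<rho> > 0"
  shows "\<exists>L\<in>Lfam (Suc (Suc m)). f \<in> interior L
    \<and> (\<forall>j<m. \<forall>l\<in>{j<..m}. \<forall>e\<in>{1, -1}. f + ray b m \<rho> j l e \<in> L)"
proof -
  note D' = dual_systemD[OF D]
  define \<tau> where "\<tau> = \<lceil>t\<rceil> - t"
  define \<tau>' where "\<tau>' = t - \<lfloor>t\<rfloor>"
  have t1: "\<tau> + \<tau>' = 1" using t by (simp add: \<tau>_def \<tau>'_def ceiling_altdef) (metis Ints_of_int)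
  have pos: "\<tau> > 0" "\<tau>' > 0" using t
    by (simp_all add: \<tau>_def \<tau>'_def) (metis Ints_of_int ceiling_correct floor_correct order_le_less)+
  \<comment> \<open>One slope for all demands: at least 1 so that a single integer step lowers a
    bound from 1 to at most 0, and large enough to keep coordinates of size \<open>\<rho>\<close>
    within all later facets.\<close>
  define M where "M = 1 + 2 * \<rho> + \<rho> / \<tau> + \<rho> / \<tau>'"
  have M: "M \<ge> 1" "M \<ge> 2 * \<rho>" "M \<ge> \<rho> / \<tau>" "M \<ge> \<rho> / \<tau>'"
    using \<rho> pos by (auto simp: M_def intro!: add_nonneg_nonneg)
  define S where "S = (\<lambda>q. M *\<^sub>R (\<Sum>l<q. u l))"
  define g where "g = (\<lambda>q. if q < m then u q - S q else if q = m then (1/\<tau>) *\<^sub>R u m - S m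
    else - (1/\<tau>') *\<^sub>R u m - S m)"
  have S0: "S 0 \<bullet> x = 0" for x by (simp add: S_def)
  have SS: "S (Suc q) \<bullet> x = S q \<bullet> x + M * (u q \<bullet> x)" for q x
    by (simp add: S_def inner_add_left algebra_simps)
  have uf: "u q \<bullet> f = 0" if "q < m" for q using that by (simp add: f D')
  have umf: "u m \<bullet> f = t" by (simp add: f D')
  have Sf: "S q \<bullet> f = 0" if "q \<le> m" for q
    using that by (induction q) (auto simp: S0 SS uf)
  let ?L = "polyh (g ` {..Suc m}) f"
  have "?L \<in> Lfam (Suc (Suc m))"
  proof (rule polyh_in_Lfam)
    show "card (g ` {..Suc m}) \<le> Suc (Suc m)" using card_image_le[of "{..Suc m}" g] by simp
    fix z :: "real^'n" assume z: "int_vec z"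
    show "\<exists>h\<in>g ` {..Suc m}. 1 \<le> h \<bullet> (z - f)"
    proof (rule ccontr)
      assume "\<not> ?thesis"
      then have lt: "g q \<bullet> (z - f) < 1" if "q \<le> Suc m" for q using that by force
      have ltq: "u q \<bullet> z < 1 + S q \<bullet> z" if "q < m" for q
        using lt[of q] that by (simp add: g_def inner_diff_left inner_diff_right uf Sf)
      \<comment> \<open>While the bound is 1, the integer \<open>u q \<bullet> z\<close> is at most
        0: value 0 keeps the bound, a negative value drops it by at least \<open>M\<close>, and a
        nonpositive bound never recovers.\<close>
      have S01: "1 + S q \<bullet> z = 1 \<or> 1 + S q \<bullet> z \<le> 0" if "q \<le> m" for q
        using that
      proof (induction q)
        case (Suc q)
        obtain k where k: "u q \<bullet> z = of_int k"
          using int_vec_inner[OF D'(1) z] Suc.prems Ints_cases by (metis less_SucI less_eq_Suc_le)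
        have lt': "of_int k < 1 + S q \<bullet> z" using ltq[of q] Suc.prems k by simp
        consider "1 + S q \<bullet> z = 1" "k = 0" | "1 + S q \<bullet> z = 1" "k \<le> -1" | "1 + S q \<bullet> z \<le> 0" "k \<le> 0"
          using Suc lt' by force
        then show ?case
        proof cases
          case 2
          then have "M * of_int k \<le> M * (-1)" using M(1) by (intro mult_left_mono) auto
          then show ?thesis using 2 M(1) by (simp add: SS k)
        next
          case 3
          then have "M * of_int k \<le> M * 0" using M(1) by (intro mult_left_mono) auto
          then show ?thesis using 3 by (simp add: SS k)
        qed (simp add: SS k)
      qed (simp add: S0)
      define \<Sigma> where "\<Sigma> = 1 + S m \<bullet> z"
      have "g m \<bullet> (z - f) < 1" "g (Suc m) \<bullet> (z - f) < 1" using lt by auto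
      then have "(u m \<bullet> z - t) / \<tau> < \<Sigma>" "- (u m \<bullet> z - t) / \<tau>' < \<Sigma>"
        by (auto simp: g_def inner_diff_left inner_diff_right umf Sf \<Sigma>_def diff_divide_distrib)
      then have zz: "u m \<bullet> z - t < \<tau> * \<Sigma>" "- (u m \<bullet> z - t) < \<tau>' * \<Sigma>"
        using pos by (auto simp: divide_less_eq mult.commute)
      \<comment> \<open>The two closing facets together make the bound positive, hence 1, which
        traps the integer \<open>u m \<bullet> z\<close> strictly between the floor and the ceiling
        of \<open>t\<close>.\<close>
      then have "0 < (\<tau> + \<tau>') * \<Sigma>" unfolding distrib_right by linarith
      then have "\<Sigma> = 1" using S01[of m] t1 by (auto simp: \<Sigma>_def)
      then have "u m \<bullet> z < \<lceil>t\<rceil>" "\<lfloor>t\<rfloor> < u m \<bullet> z" using zz by (auto simp: \<tau>_def \<tau>'_def)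
      moreover obtain k where "u m \<bullet> z = of_int k" using int_vec_inner[OF D'(1) z] Ints_cases by blast
      ultimately show False using ceiling_diff_floor_le_1[of t] by simp
    qed
  qed simp
  moreover have "f \<in> interior ?L" by (simp add: interior_polyh)
  \<comment> \<open>Before \<open>j\<close> all coordinates vanish, at \<open>j\<close> the
    inequality is tight, and afterwards the slope term is at least \<open>M\<close> and absorbs the
    later coordinates.\<close>
  moreover have "f + ray b m \<rho> j l e \<in> ?L" if j: "j < m" and l: "l \<in> {j<..m}" and e: "e \<in> {1, -1}" for j l e
  proof -
    let ?x = "ray b m \<rho> j l e"
    have ux: "u k \<bullet> ?x = (if k = j then 1 else 0) + (if j < k \<and> k < m then \<rho> else 0) + (if k = l then e * \<rho> else 0)"
      if "k \<le> m" for k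
    proof -
      have "(\<Sum>q\<in>{j<..<m}. u k \<bullet> b q) = (\<Sum>q\<in>{j<..<m}. if q = k then 1 else 0)"
        by (rule sum.cong) (use that in \<open>auto simp: D'\<close>)
      then show ?thesis using that j l by (simp add: ray_def inner_add_right inner_sum_right D')
    qed
    have u0: "u k \<bullet> ?x = 0" if "k < j" for k using that j l by (simp add: ux)
    have uj: "u j \<bullet> ?x = 1" using j l by (simp add: ux)
    have uk: "0 \<le> u k \<bullet> ?x" "u k \<bullet> ?x \<le> 2 * \<rho>" if "j < k" "k < m" for k
      using that j l e \<rho> by (auto simp: ux)
    have um: "u m \<bullet> ?x \<le> \<rho>" "- \<rho> \<le> u m \<bullet> ?x" using j l e \<rho> by (auto simp: ux)
    have Sj0: "S q \<bullet> ?x = 0" if "q \<le> j" for q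
      using that by (induction q) (auto simp: S0 SS u0)
    have Sx: "S q \<bullet> ?x \<ge> M" if "j < q" "q \<le> m" for q
      using that
    proof (induction q)
      case (Suc q)
      show ?case
      proof (cases "q = j")
        case True
        then show ?thesis by (simp add: SS Sj0 uj)
      next
        case False
        then have "M * (u q \<bullet> ?x) \<ge> 0" using M(1) uk(1)[of q] Suc.prems by (intro mult_nonneg_nonneg) auto
        then show ?thesis using Suc False by (simp add: SS)
      qed
    qed simp
    have "g q \<bullet> ?x \<le> 1" if qm: "q \<le> Suc m" for q
    proof -
      consider "q < j" | "q = j" | "j < q" "q < m" | "q = m" | "q = Suc m"
        using qm by linarith
      then show ?thesis
      proof cases
        case 1
        then show ?thesis using j by (simp add: g_def inner_diff_left u0 Sj0)
      next
        case 2
        then show ?thesis using j by (simp add: g_def inner_diff_left uj Sj0)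
      next
        case 3
        then show ?thesis using Sx[of q] uk(2)[of q] M(2) by (simp add: g_def inner_diff_left)
      next
        case 4
        have "(u m \<bullet> ?x) / \<tau> \<le> \<rho> / \<tau>" using um(1) pos by (intro divide_right_mono) auto
        then show ?thesis using 4 Sx[of m] j M(3) by (simp add: g_def inner_diff_left)
      next
        case 5
        have "- (u m \<bullet> ?x) / \<tau>' \<le> \<rho> / \<tau>'" using um(2) pos by (intro divide_right_mono) auto
        then show ?thesis using 5 Sx[of m] j M(4) by (simp add: g_def inner_diff_left)
      qed
    qed
    then show ?thesis by (auto simp: polyh_def)
  qed
  ultimately show ?thesis by blast
qed

section \<open>Integer points in bodies with few facets\<close>

lemma integer_point_in_cone:
  fixes G :: "(real^'n) set"
  assumes "finite G" and d: "\<And>g. g \<in> G \<Longrightarrow> g \<bullet> d = -1"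
  shows "\<exists>z. int_vec z \<and> (\<forall>g\<in>G. g \<bullet> (z - f) < 1)"
proof -
  \<comment> \<open>Moving by \<open>N d\<close> lowers every constraint by \<open>N\<close>, which
    outweighs the error from rounding to an integer point.\<close>
  define N where "N = (\<Sum>g\<in>G. norm g) * CARD('n)"
  obtain z where z: "int_vec z" "norm (z - (f + N *\<^sub>R d)) \<le> CARD('n)" using int_vec_round by blast
  have "g \<bullet> (z - f) < 1" if "g \<in> G" for g
  proof -
    have "g \<bullet> (z - (f + N *\<^sub>R d)) \<le> norm g * norm (z - (f + N *\<^sub>R d))" by (rule norm_cauchy_schwarz)
    also have "\<dots> \<le> (\<Sum>g\<in>G. norm g) * CARD('n)"
      using z(2) that assms(1) by (intro mult_mono) (auto intro: member_le_sum sum_nonneg)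
    finally show ?thesis using d[OF that] by (simp add: N_def inner_diff_right inner_add_right)
  qed
  then show ?thesis using z(1) by blast
qed

lemma independent_imp_common_value:
  fixes G :: "'a::euclidean_space set"
  assumes "independent G"
  shows "\<exists>d. \<forall>g\<in>G. g \<bullet> d = c"
proof -
  obtain h :: "'a \<Rightarrow> real" where h: "linear h" "\<forall>x\<in>G. h x = c"
    using linear_independent_extend[OF assms, of "\<lambda>_. c"] by blast
  then show ?thesis using adjoint_works[OF h(1), of _ 1] by (intro exI[of _ "adjoint h 1"]) auto
qed

lemma dual_system_span:
  fixes b :: "nat \<Rightarrow> real^'n"
  assumes D: "dual_system m u b"
  shows dim_span_dual_system: "dim (span (b ` {..<m})) = m"
    and dual_system_expansion: "w \<in> span (b ` {..<m}) \<Longrightarrow> w = (\<Sum>l<m. (u l \<bullet> w) *\<^sub>R b l)"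
proof -
  note D' = dual_systemD[OF D]
  have inj: "inj_on b {..<m}"
    by (rule inj_onI) (metis D'(3) lessThan_iff zero_neq_one)
  have coeff: "u k \<bullet> (\<Sum>l<m. c l *\<^sub>R b l) = c k" if "k < m" for c k
  proof -
    have "u k \<bullet> (\<Sum>l<m. c l *\<^sub>R b l) = (\<Sum>l<m. if l = k then c k else 0)"
      unfolding inner_sum_right by (rule sum.cong) (use that in \<open>auto simp: D'\<close>)
    then show ?thesis using that by simp
  qed
  have "independent (b ` {..<m})"
  proof (rule independent_if_scalars_zero)
    fix c x assume "(\<Sum>x\<in>b ` {..<m}. c x *\<^sub>R x) = 0" "x \<in> b ` {..<m}"
    then show "c x = 0" using coeff[of _ "\<lambda>l. c (b l)"] by (auto simp: sum.reindex[OF inj] o_def)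
  qed simp
  then show "dim (span (b ` {..<m})) = m" using inj by (simp add: dim_eq_card_independent card_image)
  assume w: "w \<in> span (b ` {..<m})"
  have "linear (\<lambda>w. \<Sum>l<m. (u l \<bullet> w) *\<^sub>R b l)"
    by (rule linearI) (simp_all add: inner_add_right scaleR_left_distrib sum.distrib scaleR_sum_right)
  from linear_eq_on_span[OF linear_id this _ w]
  show "w = (\<Sum>l<m. (u l \<bullet> w) *\<^sub>R b l)"
  proof -
    have "b k = (\<Sum>l<m. (u l \<bullet> b k) *\<^sub>R b l)" if "k < m" for k
    proof -
      have "(\<Sum>l<m. (u l \<bullet> b k) *\<^sub>R b l) = (\<Sum>l<m. if l = k then b k else 0)"
        by (rule sum.cong) (use that in \<open>auto simp: D'\<close>)
      then show ?thesis using that by simp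
    qed
    then show ?thesis
      using \<open>(\<And>x. x \<in> b ` {..<m} \<Longrightarrow> id x = (\<Sum>l<m. (u l \<bullet> x) *\<^sub>R b l)) \<Longrightarrow> id w = (\<Sum>l<m. (u l \<bullet> w) *\<^sub>R b l)\<close>
      by auto
  qed
qed

text \<open>Dimension count: the orthogonal complement of \<open>G\<close> is too large to meet
  \<open>V\<close> trivially.\<close>

lemma exists_orthogonal_in_subspace:
  fixes G V :: "'a::euclidean_space set"
  assumes "subspace V" "dim G < dim V"
  obtains w where "w \<in> V" "w \<noteq> 0" "\<And>g. g \<in> G \<Longrightarrow> g \<bullet> w = 0"
proof -
  define T where "T = {y \<in> UNIV. \<forall>x\<in>span G. orthogonal x y}"
  have T: "dim T + dim (span G) = DIM('a)"
    unfolding T_def using dim_subspace_orthogonal_to_vectors[of "span G" UNIV] by simp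
  have "subspace T" unfolding T_def
    by (auto simp: subspace_def orthogonal_clauses)
  then have "dim {x + y |x y. x \<in> V \<and> y \<in> T} + dim (V \<inter> T) = dim V + dim T"
    using dim_sums_Int[OF assms(1)] by blast
  moreover have "dim {x + y |x y. x \<in> V \<and> y \<in> T} \<le> DIM('a)" by (rule dim_subset_UNIV)
  ultimately have "dim (V \<inter> T) > 0" using T assms(2) by simp
  then obtain w where "w \<in> V \<inter> T" "w \<noteq> 0" by (metis dim_eq_0 neq0_conv singleton_iff subsetI)
  then show thesis using that[of w] by (auto simp: T_def orthogonal_def intro: span_base)
qed

text \<open>Dependent normals leave a direction \<open>w'\<close> along which all constraints are
  constant. If all test rays stayed below \<open>1 / \<sigma>\<close>, every constraint would be
  below 1 on \<open>\<sigma>\<close> times the cross-polytope, and translating that along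
  \<open>w'\<close> reaches an integer point.\<close>

lemma few_facets_miss_ray:
  fixes f :: "real^'n"
  assumes D: "dual_system (Suc m) u b" and f: "f = t *\<^sub>R b m"
    and \<sigma>: "\<sigma> > 0" and \<rho>: "\<rho> = Suc m / \<sigma>"
    and G: "finite G" "card G \<le> Suc m" and free: "\<And>z. int_vec z \<Longrightarrow> \<exists>g\<in>G. g \<bullet> (z - f) \<ge> 1"
  shows "\<exists>j<m. \<exists>l\<in>{j<..m}. \<exists>e\<in>{1, -1}. \<exists>g\<in>G. g \<bullet> ray b m \<rho> j l e \<ge> 1 / \<sigma>"
proof (rule ccontr)
  assume neg: "\<not> ?thesis"
  have lt: "g \<bullet> ray b m \<rho> j l e < 1 / \<sigma>" if "j < m" "l \<in> {j<..m}" "e \<in> {1, -1}" "g \<in> G" for j l e g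
    using neg that by (meson not_le)
  note D' = dual_systemD[OF D]
  have \<rho>0: "\<rho> > 0" using \<sigma> \<rho> by simp
  \<comment> \<open>Independent normals would share a descent direction, and the resulting cone
    contains an integer point.\<close>
  have "\<not> independent G"
  proof
    assume "independent G"
    then obtain d where "\<forall>g\<in>G. g \<bullet> d = -1" using independent_imp_common_value by blast
    then obtain z where "int_vec z" "\<forall>g\<in>G. g \<bullet> (z - f) < 1"
      using integer_point_in_cone[OF G(1), of d f] by blast
    then show False using free[of z] by force
  qed
  then have "dim G < card G" using card_le_dim_spanning[of G G] G(1) span_superset by (force simp: not_le)
  then have "dim G < dim (span (b ` {..<Suc m}))" using G(2) dim_span_dual_system[OF D] by simp
  then obtain w where w: "w \<in> span (b ` {..<Suc m})" "w \<noteq> 0" "\<And>g. g \<in> G \<Longrightarrow> g \<bullet> w = 0"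
    using exists_orthogonal_in_subspace[OF subspace_span] by blast
  have we: "w = (\<Sum>l<Suc m. (u l \<bullet> w) *\<^sub>R b l)" by (rule dual_system_expansion[OF D w(1)])
  have ex: "\<exists>j. j \<le> m \<and> u j \<bullet> w \<noteq> 0"
  proof (rule ccontr)
    assume "\<not> ?thesis"
    then have "(\<Sum>l<Suc m. (u l \<bullet> w) *\<^sub>R b l) = 0" by (intro sum.neutral) auto
    then show False using we w(2) by simp
  qed
  \<comment> \<open>The first nonzero coordinate of \<open>w\<close>, later scaled to 1, selects the
    cross-polytope to use.\<close>
  define j where "j = (LEAST j. j \<le> m \<and> u j \<bullet> w \<noteq> 0)"
  have j: "j \<le> m" "u j \<bullet> w \<noteq> 0" using LeastI_ex[OF ex] by (auto simp: j_def)
  have below: "u l \<bullet> w = 0" if "l < j" for l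
    using not_less_Least[of l "\<lambda>j. j \<le> m \<and> u j \<bullet> w \<noteq> 0"] that j(1) by (auto simp: j_def)
  define I where "I = {j<..m}"
  define w' where "w' = (1 / (u j \<bullet> w)) *\<^sub>R w"
  have gw': "g \<bullet> w' = 0" if "g \<in> G" for g using w(3)[OF that] by (simp add: w'_def)
  define \<omega> where "\<omega> = (\<lambda>l. u l \<bullet> w')"
  have w'e: "w' = b j + (\<Sum>l\<in>I. \<omega> l *\<^sub>R b l)"
  proof -
    have "w' = (\<Sum>l<Suc m. \<omega> l *\<^sub>R b l)"
      unfolding w'_def \<omega>_def by (subst we) (simp add: scaleR_sum_right del: sum.lessThan_Suc)
    also have "\<dots> = (\<Sum>l\<in>insert j I. \<omega> l *\<^sub>R b l)"
      by (rule sum.mono_neutral_right) (use j below in \<open>auto simp: I_def \<omega>_def w'_def\<close>)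
    also have "\<dots> = \<omega> j *\<^sub>R b j + (\<Sum>l\<in>I. \<omega> l *\<^sub>R b l)" by (simp add: I_def)
    also have "\<omega> j = 1" using j by (simp add: \<omega>_def w'_def)
    finally show ?thesis by simp
  qed
  show False
  proof (cases "j = m")
    \<comment> \<open>The line through \<open>f\<close> in direction \<open>b m\<close> contains the
      origin, an integer point.\<close>
    case True
    then have "w' = b m" using w'e by (simp add: I_def)
    then have "g \<bullet> (0 - f) = 0" if "g \<in> G" for g using gw'[OF that] by (simp add: f)
    then show False using free[of 0] by force
  next
    case False
    then have jm: "j < m" using j by simp
    define \<kappa> where "\<kappa> = (\<lambda>l. if l < m then \<rho> else 0)"
    define c where "c = b j + \<rho> *\<^sub>R (\<Sum>q\<in>{j<..<m}. b q)"
    have I: "I = insert m {j<..<m}" using jm by (auto simp: I_def)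
    have cI: "c = b j + (\<Sum>l\<in>I. \<kappa> l *\<^sub>R b l)"
      unfolding I by (simp add: c_def \<kappa>_def scaleR_sum_right)
    have fI: "f = (\<Sum>l\<in>I. (if l = m then t else 0) *\<^sub>R b l)"
      unfolding I by (simp add: f)
    \<comment> \<open>Coordinates of \<open>f + \<sigma> c - \<sigma> w'\<close>: coordinate
      \<open>j\<close> cancels, so only those after \<open>j\<close> are rounded, and
      \<open>y\<close> is the rounding error divided by \<open>\<sigma>\<close>.\<close>
    define v where "v = (\<lambda>l. (if l = m then t else 0) - \<sigma> * \<omega> l + \<sigma> * \<kappa> l)"
    define Z where "Z = (\<lambda>l. real_of_int (round (v l)))"
    define y where "y = (\<lambda>l. (Z l - v l) / \<sigma>)"
    define z where "z = (\<Sum>l\<in>I. Z l *\<^sub>R b l)"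
    have "int_vec z" unfolding z_def
      by (intro int_vec_sum int_vec_scaleR) (auto simp: Z_def I_def D')
    then obtain g where g: "g \<in> G" "g \<bullet> (z - f) \<ge> 1" using free by blast
    have "z - f + \<sigma> *\<^sub>R w' = \<sigma> *\<^sub>R b j + (\<Sum>l\<in>I. (Z l - (if l = m then t else 0) + \<sigma> * \<omega> l) *\<^sub>R b l)"
      unfolding z_def fI w'e
      by (simp add: scaleR_add_right scaleR_sum_right sum.distrib sum_subtractf scaleR_left_distrib
          scaleR_left_diff_distrib)
    also have "(\<lambda>l. Z l - (if l = m then t else 0) + \<sigma> * \<omega> l) = (\<lambda>l. \<sigma> * (\<kappa> l + y l))"
      using \<sigma> by (auto simp: fun_eq_iff y_def v_def field_simps)
    also have "\<sigma> *\<^sub>R b j + (\<Sum>l\<in>I. (\<sigma> * (\<kappa> l + y l)) *\<^sub>R b l) = \<sigma> *\<^sub>R (c + (\<Sum>l\<in>I. y l *\<^sub>R b l))"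
      unfolding cI
      by (simp add: scaleR_add_right scaleR_sum_right sum.distrib scaleR_left_distrib distrib_left)
    finally have "g \<bullet> (z - f + \<sigma> *\<^sub>R w') = g \<bullet> (\<sigma> *\<^sub>R (c + (\<Sum>l\<in>I. y l *\<^sub>R b l)))" by simp
    then have gz: "g \<bullet> (z - f) = \<sigma> * (g \<bullet> c + (\<Sum>l\<in>I. y l * (g \<bullet> b l)))"
      using gw'[OF g(1)] by (simp add: inner_add_right inner_sum_right)
    \<comment> \<open>The slack left at \<open>c\<close>, per unit of radius, bounds every
      \<open>g \<bullet> b l\<close>. Rounding costs at most \<open>1 / (2 \<sigma>)\<close> in each
      of \<open>m - j\<close> coordinates, less than \<open>\<rho>\<close> in total.\<close>
    define E where "E = (1 / \<sigma> - g \<bullet> c) / \<rho>"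
    have bE: "\<bar>g \<bullet> b l\<bar> < E" if "l \<in> I" for l
    proof -
      have "g \<bullet> c + \<rho> * (g \<bullet> b l) < 1 / \<sigma>" "g \<bullet> c - \<rho> * (g \<bullet> b l) < 1 / \<sigma>"
        using lt[OF jm, of l 1 g] lt[OF jm, of l "-1" g] that g(1)
        by (auto simp: I_def ray_def c_def inner_add_right inner_diff_right)
      then have "\<rho> * \<bar>g \<bullet> b l\<bar> < 1 / \<sigma> - g \<bullet> c" using \<rho>0 by (auto simp: abs_if)
      then show ?thesis using \<rho>0 by (simp add: E_def field_simps)
    qed
    have "m \<in> I" using jm by (simp add: I_def)
    then have E0: "E > 0" using bE[of m] by (meson abs_ge_zero le_less_trans)
    have yb: "\<bar>y l\<bar> \<le> 1 / (2 * \<sigma>)" for l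
      using of_int_round_abs_le[of "v l"] \<sigma> by (simp add: y_def Z_def abs_divide field_simps)
    have "(\<Sum>l\<in>I. y l * (g \<bullet> b l)) \<le> (\<Sum>l\<in>I. 1 / (2 * \<sigma>) * E)"
    proof (rule sum_mono)
      fix l assume "l \<in> I"
      have "y l * (g \<bullet> b l) \<le> \<bar>y l\<bar> * \<bar>g \<bullet> b l\<bar>" by (metis abs_ge_self abs_mult)
      also have "\<dots> \<le> 1 / (2 * \<sigma>) * E" using yb[of l] bE[OF \<open>l \<in> I\<close>] \<sigma> by (intro mult_mono) auto
      finally show "y l * (g \<bullet> b l) \<le> 1 / (2 * \<sigma>) * E" .
    qed
    also have "\<dots> = (m - j) / (2 * \<sigma>) * E" by (simp add: I_def)
    also have "\<dots> < \<rho> * E"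
    proof (rule mult_strict_right_mono[OF _ E0])
      show "real (m - j) / (2 * \<sigma>) < \<rho>" using \<sigma> by (simp add: \<rho> field_simps)
    qed
    also have "\<rho> * E = 1 / \<sigma> - g \<bullet> c" using \<rho>0 by (simp add: E_def)
    finally have "g \<bullet> c + (\<Sum>l\<in>I. y l * (g \<bullet> b l)) < 1 / \<sigma>" by simp
    then have "g \<bullet> (z - f) < 1" unfolding gz using \<sigma> by (simp add: field_simps)
    then show False using g(2) by simp
  qed
qed

text \<open>The point with \<open>card T\<close> entries equal to \<open>\<sigma>\<close> separates
  the cuts: against each \<open>B\<close> a single ray already contributes 1, while \<open>a\<close>
  times the point stays below 1 against \<open>L\<close>, whose gauge is at most 1 on
  \<open>T\<close>. No factor is then admissible and the infimum is over the empty set.\<close>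

lemma rho_eq_infinity:
  fixes f :: "real^'n"
  assumes *: "\<And>a. a > 0 \<Longrightarrow> \<exists>T \<sigma>. \<exists>L\<in>\<L>. finite T \<and> \<sigma> > 0 \<and> real (card T) * \<sigma> * a < 1
    \<and> f \<in> interior L \<and> (\<forall>r\<in>T. f + r \<in> L)
    \<and> (\<forall>B\<in>\<B>. f \<in> interior B \<longrightarrow> (\<exists>r\<in>T. 1 / \<sigma> \<le> gauge ((\<lambda>x. x - f) ` B) r))"
  shows "rho f \<B> \<L> = \<infinity>"
proof -
  have "\<exists>k R. \<not> cut_fam \<B> k R f \<subseteq> (\<lambda>s j. s j / a) ` cut_fam \<L> k R f" if a: "a > 0" for a
  proof -
    obtain T \<sigma> L where L: "L \<in> \<L>" "finite T" "\<sigma> > 0" "real (card T) * \<sigma> * a < 1" "f \<in> interior L"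
      "\<And>r. r \<in> T \<Longrightarrow> f + r \<in> L"
      and B: "\<And>B. B \<in> \<B> \<Longrightarrow> f \<in> interior B \<Longrightarrow> \<exists>r\<in>T. 1 / \<sigma> \<le> gauge ((\<lambda>x. x - f) ` B) r"
      using *[OF a] by blast
    let ?k = "card T"
    obtain R where R: "bij_betw R {0..<?k} T" using ex_bij_betw_nat_finite[OF L(2)] by blast
    have RT: "R ` {..<?k} = T" using R by (simp add: bij_betw_def atLeast0LessThan)
    define s where "s = (\<lambda>j. if j < ?k then \<sigma> else 0)"
    have so: "s \<in> orthant ?k" using L(3) by (simp add: s_def orthant_def)
    have "s \<in> cut_set B ?k R f" if BB: "B \<in> \<B>" for B
    proof (cases "f \<in> interior B")
      case True
      obtain r where r: "r \<in> T" "1 / \<sigma> \<le> gauge ((\<lambda>x. x - f) ` B) r" using B[OF BB True] by blast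
      then obtain j0 where j0: "j0 < ?k" "1 / \<sigma> \<le> gauge ((\<lambda>x. x - f) ` B) (R j0)"
        using RT by (metis imageE lessThan_iff)
      have "1 \<le> s j0 * gauge ((\<lambda>x. x - f) ` B) (R j0)"
        using j0 L(3) by (simp add: s_def field_simps)
      also have "\<dots> \<le> (\<Sum>j<?k. s j * gauge ((\<lambda>x. x - f) ` B) (R j))"
        by (rule member_le_sum) (use j0 so gauge_nonneg[OF True] in \<open>auto simp: orthant_def\<close>)
      finally show ?thesis using True so by (simp add: cut_set_def)
    qed (simp add: cut_set_def so)
    then have "s \<in> cut_fam \<B> ?k R f" using so by (simp add: cut_fam_def)
    moreover have "s \<notin> (\<lambda>s j. s j / a) ` cut_fam \<L> ?k R f"
    proof
      assume "s \<in> (\<lambda>s j. s j / a) ` cut_fam \<L> ?k R f"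
      then obtain s' where s': "s' \<in> cut_fam \<L> ?k R f" "s = (\<lambda>j. s' j / a)" by blast
      have s'j: "s' j = a * \<sigma>" if "j < ?k" for j
      proof -
        have "s' j / a = \<sigma>" using fun_cong[OF s'(2), of j] that by (simp add: s_def)
        then show ?thesis using a by (simp add: field_simps)
      qed
      have "1 \<le> (\<Sum>j<?k. s' j * gauge ((\<lambda>x. x - f) ` L) (R j))"
        using s'(1) L(1,5) by (auto simp: cut_fam_def cut_set_def)
      also have "\<dots> \<le> (\<Sum>j<?k. a * \<sigma> * 1)"
      proof (rule sum_mono)
        fix j assume j: "j \<in> {..<?k}"
        then have "R j \<in> T" using RT by blast
        then have "gauge ((\<lambda>x. x - f) ` L) (R j) \<le> 1" using L(6) by (intro gauge_le) auto
        then show "s' j * gauge ((\<lambda>x. x - f) ` L) (R j) \<le> a * \<sigma> * 1"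
          using s'j[of j] j a L(3) by (intro mult_mono) (auto intro: gauge_nonneg[OF L(5)])
      qed
      also have "\<dots> < 1" using L(4) by (simp add: algebra_simps)
      finally show False by simp
    qed
    ultimately show ?thesis by blast
  qed
  then have empty: "{ereal \<alpha> | \<alpha>. \<alpha> > 0 \<and>
      (\<forall>k R. cut_fam \<B> k R f \<subseteq> (\<lambda>s j. s j / \<alpha>) ` cut_fam \<L> k R f)} = {}" by blast
  show ?thesis unfolding rho_def empty by (simp add: top_ereal_def)
qed

lemma rho_Lfam_Suc_eq_infinity:
  fixes f :: "real^'n"
  assumes i: "1 \<le> i" "i \<le> CARD('n)" and f: "rat_vec f" "\<not> int_vec f"
  shows "rho f (Lfam i) (Lfam (Suc i)) = \<infinity>"
proof (rule rho_eq_infinity)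
  fix a :: real assume a: "a > 0"
  obtain m where m: "i = Suc m" using i(1) by (cases i) auto
  obtain u b t where D: "dual_system (Suc m) u b" "f = t *\<^sub>R b m" "t \<notin> \<int>"
    using dual_system_adapted[OF f] i(2) m by blast
  define Idx where "Idx = {..<m} \<times> {..m} \<times> {1, -1 :: real}"
  \<comment> \<open>The number of test rays is at most \<open>card Idx\<close> whatever
    \<open>\<rho>\<close> is, so \<open>\<sigma>\<close> can be fixed first and the steepness of the
    pyramid afterwards.\<close>
  define \<sigma> where "\<sigma> = 1 / (a * Suc (card Idx))"
  have \<sigma>: "\<sigma> > 0" using a by (simp add: \<sigma>_def)
  define \<rho> where "\<rho> = Suc m / \<sigma>"
  define T where "T = (\<lambda>(j, l, e). ray b m \<rho> j l e) ` {(j, l, e) \<in> Idx. j < l}"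
  have fin: "finite Idx" by (simp add: Idx_def)
  have "finite T" unfolding T_def by (intro finite_imageI finite_subset[OF _ fin]) auto
  have "card T \<le> card {(j, l, e) \<in> Idx. j < l}"
    unfolding T_def by (intro card_image_le finite_subset[OF _ fin]) auto
  also have "\<dots> \<le> card Idx" by (intro card_mono fin) auto
  finally have "real (card T) * \<sigma> * a < 1" using a by (simp add: \<sigma>_def divide_less_eq)
  have "\<rho> > 0" using \<sigma> by (simp add: \<rho>_def)
  from iterated_pyramid[OF D this] obtain L where L: "L \<in> Lfam (Suc i)" "f \<in> interior L"
    and LT: "\<forall>j<m. \<forall>l\<in>{j<..m}. \<forall>e\<in>{1, -1}. f + ray b m \<rho> j l e \<in> L"
    unfolding m by blast
  have "\<forall>r\<in>T. f + r \<in> L" using LT by (auto simp: T_def Idx_def)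
  moreover have "\<exists>r\<in>T. 1 / \<sigma> \<le> gauge ((\<lambda>x. x - f) ` B) r" if B: "B \<in> Lfam i" "f \<in> interior B" for B
  proof -
    have B': "polyhedron B" "card {c. c facet_of B} \<le> Suc m" using B(1) m by (simp_all add: Lfam_def)
    obtain G where G: "finite G" "card G \<le> Suc m" "B = polyh G f"
      using polyhedron_eq_polyh[OF B'(1) B(2)] B'(2) by (metis le_trans)
    have "\<exists>g\<in>G. g \<bullet> (z - f) \<ge> 1" if "int_vec z" for z
    proof -
      have "z \<notin> interior B" using B(1) that by (auto simp: Lfam_def lattice_free_def)
      then show ?thesis by (auto simp: G(3) interior_polyh[OF G(1)] not_less)
    qed
    from few_facets_miss_ray[OF D(1,2) \<sigma> \<rho>_def G(1,2) this]
    obtain j l e g where r: "j < m" "l \<in> {j<..m}" "e \<in> {1, -1}" "g \<in> G" "g \<bullet> ray b m \<rho> j l e \<ge> 1 / \<sigma>"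
      by blast
    have "1 / \<sigma> \<le> gauge ((\<lambda>x. x - f) ` B) (ray b m \<rho> j l e)"
    proof (rule gauge_ge[OF B(2)])
      fix s :: real assume s: "s > 0" "f + (1/s) *\<^sub>R ray b m \<rho> j l e \<in> B"
      then have "g \<bullet> ray b m \<rho> j l e \<le> s" using r(4) by (auto simp: G(3) polyh_def)
      then show "1 / \<sigma> \<le> s" using r(5) by simp
    qed
    moreover have "ray b m \<rho> j l e \<in> T" unfolding T_def
      by (rule image_eqI[of _ _ "(j, l, e)"]) (use r in \<open>auto simp: Idx_def\<close>)
    ultimately show ?thesis by blast
  qed
  ultimately show "\<exists>T \<sigma>. \<exists>L\<in>Lfam (Suc i). finite T \<and> \<sigma> > 0 \<and> real (card T) * \<sigma> * a < 1
    \<and> f \<in> interior L \<and> (\<forall>r\<in>T. f + r \<in> L)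
    \<and> (\<forall>B\<in>Lfam i. f \<in> interior B \<longrightarrow> (\<exists>r\<in>T. 1 / \<sigma> \<le> gauge ((\<lambda>x. x - f) ` B) r))"
    using L \<open>finite T\<close> \<sigma> \<open>real (card T) * \<sigma> * a < 1\<close> by blast
qed

theorem theorem2p2:
  fixes f :: "real^'n" and i :: nat
  assumes "2 \<le> i" and "i \<le> 2 ^ CARD('n)"
    and "rat_vec f" and "\<not> int_vec f"
  shows "(i \<le> CARD('n) \<longrightarrow> rho f (Lfam i) (Lfam (Suc i)) = \<infinity>)
       \<and> (i > CARD('n) \<longrightarrow>
            rho f (Lfam i) Lstar \<le> Flt TYPE('n) * ereal (4 ^ (CARD('n) - 1) * real (denom_vec f)))"
  using rho_Lfam_Suc_eq_infinity[of i f] rho_Lfam_Lstar_le[where f = f and i = i] assms by simp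

end
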